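(* Let $n\ge 1$ and $\sigma^2>0$, and let $y$ be the stationary Gaussian ARMA$(n,n)$ process with parameter $\theta=(a_1,\dots,a_n,c_1,\dots,c_n)$ and innovation variance $\sigma^2$ described in the context. Then its asymptotic Fisher information matrix $I(\theta,\sigma^2)$ is the same as the matrix $I(\theta)=M(c,a)^{-1}H(\theta)M(c,a)^{-\top}$. Hence it is the unique solution $I$ of the Stein equation $$I=FIF^\top+BB^\top,$$ and thus independent of $\sigma^2$. Moreover, this matrix is non-singular if and only if the polynomials $a(z)=1+a_1z+\cdots+a_nz^n$ and $c(z)=1+c_1z+\cdots+c_nz^n$ have no common factors.
   Context: Polynomials: $\hat a(z)=z^n+a_1z^{n-1}+\cdots+a_n$ and $\hat c(z)=z^n+c_1z^{n-1}+\cdots+c_n$ have real coefficients and all their zeros lie in the open unit disc. Their reciprocals are $a(z)=z^n\hat a(z^{-1})=1+a_1z+\cdots+a_nz^n$ and $c(z)=z^n\hat c(z^{-1})=1+c_1z+\cdots+c_nz^n$; put $a_0=c_0=1$. The same letters denote the column vectors $a=(a_1,\dots,a_n)^\top$, $c=(c_1,\dots,c_n)^\top$. Common factors are understood to be non-constant. Process: $y$ is the stationary process with $a(L)y=c(L)\varepsilon$, where $L$ is the lag operator and $\varepsilon$ is a Gaussian white noise sequence (independent, mean $0$) with known variance $\sigma^2$. The derivatives of $\varepsilon_t=\varepsilon_t(\theta)$ with respect to the parameters are the stationary processes $\varepsilon^{a_j}_t=\frac{1}{a(L)}\varepsilon_{t-j}$ and $\varepsilon^{c_l}_t=-\frac{1}{c(L)}\varepsilon_{t-l}$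 ($1\le j,l\le n$), where $1/a(L)$, $1/c(L)$ are the power series expansions in $L$. Let $\dot\varepsilon_t$ be the row vector $(\varepsilon_t^{a_1},\dots,\varepsilon_t^{a_n},\varepsilon_t^{c_1},\dots,\varepsilon_t^{c_n})$. Fisher information: given $N$ observations, the score is the row vector $\dot\ell_N(\theta)=-\frac1{\sigma^2}\sum_{t=1}^N\varepsilon_t(\theta)\dot\varepsilon_t(\theta)$; under stationarity its covariance matrix is $N\,I(\theta,\sigma^2)$, where the asymptotic Fisher information matrix is $I(\theta,\sigma^2)=\frac{1}{\sigma^2}\mathbb{E}\,\dot\varepsilon_t^\top\dot\varepsilon_t$ (a $2n\times 2n$ matrix). Matrices: $e$ is the first standard basis vector of $\mathbb{R}^n$; $J$ is the $n\times n$ shift matrix, $J_{ij}=1$ if $i=j+1$ and $0$ otherwise; $P$ is the $n\times n$ anti-diagonal identity, $P_{ij}=\delta_{i,n+1-j}$; $$F=\begin{pmatrix}J-ea^\top&0\\0&J-ec^\top\end{pmatrix},\qquad B=\begin{pmatrix}e\\ -e\end{pmatrix}.$$ $S(\hat a)$ is the $n\times n$ matrix with $S(\hat a)_{ij}=a_{n+1-i-j}$ if $i+j\le n+1$ and $0$ otherwise (so its first row is $(a_{n-1},\dots,a_1,a_0)$), and $S(\hat c)$ is defined likewise from $c$. Put $$M(c,a)=\begin{pmatrix}P&0\\ P S(\hat a)P&P S(\hat c)P\end{pmatrix},$$ which is invertible; $M(c,a)^{-\top}$ denotes the transpose of $M(c,a)^{-1}$. $H(\theta)$ is the unique solution of the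 Stein equation $H=G_MHG_M^\top+e_Pe_P^\top$, where $e_P=\begin{pmatrix}Pe\\0\end{pmatrix}\in\mathbb{R}^{2n}$ and $$G_M=\begin{pmatrix}P(J-ea^\top)P&0\\ (c-a)e^\top&PJP-ce^\top\end{pmatrix}.$$
   Formalization: The non-singularity criterion for a(z), c(z) is stated only when a_n ≠ 0 or c_n ≠ 0 (it fails for n=1, a_1=c_1=0, where a=c=1 but I is singular); an unconditional criterion is added using common factors of the polynomials â, ĉ. *)

theory Defs
  imports
    "HOL-Probability.Probability"
    "HOL-Computational_Algebra.Polynomial_FPS"
    "Jordan_Normal_Form.Gauss_Jordan_Elimination"
begin

(* Both libraries use the infix dollar for vector components; here it is the one of
   Jordan_Normal_Form.  Vectors and matrices are indexed from 0, so a_j is a $ (j - 1) and the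
   entry (i, j) of a matrix is its (i - 1, j - 1) component. *)
unbundle no vec_syntax

section \<open>Polynomials\<close>

definition arma_coeff :: "real vec \<Rightarrow> nat \<Rightarrow> real" where
  "arma_coeff a j = (if j = 0 then 1 else a $ (j - 1))"

definition hat_poly :: "real vec \<Rightarrow> real poly" where
  "hat_poly a = (\<Sum>j\<le>dim_vec a. monom (arma_coeff a j) (dim_vec a - j))"

definition rec_poly :: "real vec \<Rightarrow> real poly" where
  "rec_poly a = (\<Sum>j\<le>dim_vec a. monom (arma_coeff a j) j)"

definition zeros_in_open_unit_disc :: "real poly \<Rightarrow> bool" where
  "zeros_in_open_unit_disc p \<longleftrightarrow>
     (\<forall>z::complex. poly (map_poly of_real p) z = 0 \<longrightarrow> cmod z < 1)"

definition has_common_factor :: "real poly \<Rightarrow> real poly \<Rightarrow> bool" where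
  "has_common_factor p q \<longleftrightarrow> (\<exists>d. degree d > 0 \<and> d dvd p \<and> d dvd q)"

section \<open>Processes\<close>

(* f(L) x for a power series f.  The series is taken pointwise in the sample space.  It is a finite
   sum when f is a polynomial; when f is the inverse of rec_poly a with all zeros of hat_poly a in
   the open unit disc and x is a white noise, it converges absolutely almost surely (and in mean
   square, to the same limit). *)
definition lag_filter :: "real fps \<Rightarrow> (int \<Rightarrow> 'w \<Rightarrow> real) \<Rightarrow> int \<Rightarrow> 'w \<Rightarrow> real" where
  "lag_filter f x t \<omega> = (\<Sum>k. fps_nth f k * x (t - int k) \<omega>)"

(* normal_density takes the standard deviation as its second argument. *)
definition gaussian_white_noise :: "'w measure \<Rightarrow> real \<Rightarrow> (int \<Rightarrow> 'w \<Rightarrow> real) \<Rightarrow> bool" where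
  "gaussian_white_noise M \<sigma>2 \<epsilon> \<longleftrightarrow>
     prob_space M \<and>
     prob_space.indep_vars M (\<lambda>_. borel) \<epsilon> UNIV \<and>
     (\<forall>t. distributed M lborel (\<epsilon> t) (normal_density 0 (sqrt \<sigma>2)))"

definition stationary_process :: "'w measure \<Rightarrow> (int \<Rightarrow> 'w \<Rightarrow> real) \<Rightarrow> bool" where
  "stationary_process M x \<longleftrightarrow>
     (\<forall>t. x t \<in> borel_measurable M) \<and>
     (\<forall>h. distr M (Pi\<^sub>M UNIV (\<lambda>_. borel)) (\<lambda>\<omega> t. x (t + h) \<omega>) =
          distr M (Pi\<^sub>M UNIV (\<lambda>_. borel)) (\<lambda>\<omega> t. x t \<omega>))"

definition arma_process ::
  "'w measure \<Rightarrow> real \<Rightarrow> real vec \<Rightarrow> real vec \<Rightarrow> (int \<Rightarrow> 'w \<Rightarrow> real) \<Rightarrow> (int \<Rightarrow> 'w \<Rightarrow> real) \<Rightarrow> bool"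
  where
  "arma_process M \<sigma>2 a c \<epsilon> y \<longleftrightarrow>
     gaussian_white_noise M \<sigma>2 \<epsilon> \<and> stationary_process M y \<and>
     (\<forall>t. AE \<omega> in M. lag_filter (fps_of_poly (rec_poly a)) y t \<omega> =
                      lag_filter (fps_of_poly (rec_poly c)) \<epsilon> t \<omega>)"

definition deriv_a :: "real vec \<Rightarrow> (int \<Rightarrow> 'w \<Rightarrow> real) \<Rightarrow> nat \<Rightarrow> int \<Rightarrow> 'w \<Rightarrow> real" where
  "deriv_a a \<epsilon> j t \<omega> = lag_filter (inverse (fps_of_poly (rec_poly a))) \<epsilon> (t - int j) \<omega>"

definition deriv_c :: "real vec \<Rightarrow> (int \<Rightarrow> 'w \<Rightarrow> real) \<Rightarrow> nat \<Rightarrow> int \<Rightarrow> 'w \<Rightarrow> real" where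
  "deriv_c c \<epsilon> l t \<omega> = - lag_filter (inverse (fps_of_poly (rec_poly c))) \<epsilon> (t - int l) \<omega>"

definition eps_dot ::
  "nat \<Rightarrow> real vec \<Rightarrow> real vec \<Rightarrow> (int \<Rightarrow> 'w \<Rightarrow> real) \<Rightarrow> int \<Rightarrow> 'w \<Rightarrow> real vec" where
  "eps_dot n a c \<epsilon> t \<omega> =
     Matrix.vec n (\<lambda>i. deriv_a a \<epsilon> (i + 1) t \<omega>) @\<^sub>v Matrix.vec n (\<lambda>i. deriv_c c \<epsilon> (i + 1) t \<omega>)"

(* By stationarity this does not depend on the time t. *)
definition fisher_information ::
  "'w measure \<Rightarrow> real \<Rightarrow> nat \<Rightarrow> real vec \<Rightarrow> real vec \<Rightarrow> (int \<Rightarrow> 'w \<Rightarrow> real) \<Rightarrow> int \<Rightarrow> real mat" where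
  "fisher_information M \<sigma>2 n a c \<epsilon> t =
     Matrix.mat (2 * n) (2 * n) (\<lambda>(i, j).
       (1 / \<sigma>2) * (\<integral>\<omega>. eps_dot n a c \<epsilon> t \<omega> $ i * eps_dot n a c \<epsilon> t \<omega> $ j \<partial>M))"

section \<open>Matrices\<close>

(* The rank one matrix u v^T. *)
definition outer_prod :: "real vec \<Rightarrow> real vec \<Rightarrow> real mat" where
  "outer_prod u v = Matrix.mat (dim_vec u) (dim_vec v) (\<lambda>(i, j). u $ i * v $ j)"

definition e_vec :: "nat \<Rightarrow> real vec" where
  "e_vec n = unit_vec n 0"

definition J_mat :: "nat \<Rightarrow> real mat" where
  "J_mat n = Matrix.mat n n (\<lambda>(i, j). if i = j + 1 then 1 else 0)"

(* i = n + 1 - j for indices starting at 1. *)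
definition P_mat :: "nat \<Rightarrow> real mat" where
  "P_mat n = Matrix.mat n n (\<lambda>(i, j). if i + j + 1 = n then 1 else 0)"

(* For indices starting at 1: the entry a_(n+1-i-j) if i + j <= n + 1. *)
definition S_mat :: "nat \<Rightarrow> real vec \<Rightarrow> real mat" where
  "S_mat n a = Matrix.mat n n (\<lambda>(i, j). if i + j + 1 \<le> n then arma_coeff a (n - 1 - i - j) else 0)"

definition F_mat :: "nat \<Rightarrow> real vec \<Rightarrow> real vec \<Rightarrow> real mat" where
  "F_mat n a c = four_block_mat
     (J_mat n - outer_prod (e_vec n) a) (0\<^sub>m n n)
     (0\<^sub>m n n) (J_mat n - outer_prod (e_vec n) c)"

definition B_vec :: "nat \<Rightarrow> real vec" where
  "B_vec n = e_vec n @\<^sub>v (- e_vec n)"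

definition M_mat :: "nat \<Rightarrow> real vec \<Rightarrow> real vec \<Rightarrow> real mat" where
  "M_mat n c a = four_block_mat
     (P_mat n) (0\<^sub>m n n)
     (P_mat n * S_mat n a * P_mat n) (P_mat n * S_mat n c * P_mat n)"

definition M_inv :: "nat \<Rightarrow> real vec \<Rightarrow> real vec \<Rightarrow> real mat" where
  "M_inv n c a = the (mat_inverse (M_mat n c a))"

definition G_mat :: "nat \<Rightarrow> real vec \<Rightarrow> real vec \<Rightarrow> real mat" where
  "G_mat n a c = four_block_mat
     (P_mat n * (J_mat n - outer_prod (e_vec n) a) * P_mat n) (0\<^sub>m n n)
     (outer_prod (c - a) (e_vec n)) (P_mat n * J_mat n * P_mat n - outer_prod c (e_vec n))"

definition eP_vec :: "nat \<Rightarrow> real vec" where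
  "eP_vec n = (P_mat n *\<^sub>v e_vec n) @\<^sub>v 0\<^sub>v n"

(* X is a solution of the Stein equation X = A X A^T + b b^T. *)
definition stein_solution :: "real mat \<Rightarrow> real vec \<Rightarrow> real mat \<Rightarrow> bool" where
  "stein_solution A b X \<longleftrightarrow>
     X \<in> carrier_mat (dim_vec b) (dim_vec b) \<and>
     X = A * X * transpose_mat A + outer_prod b b"

definition H_mat :: "nat \<Rightarrow> real vec \<Rightarrow> real vec \<Rightarrow> real mat" where
  "H_mat n a c = (THE H. stein_solution (G_mat n a c) (eP_vec n) H)"

end

theory Submission
  imports Defs
    "HOL-Complex_Analysis.Cauchy_Integral_Formula"
    "HOL-Computational_Algebra.Field_as_Ring"
    "HOL-Computational_Algebra.Polynomial_Factorial"
    "Jordan_Normal_Form.Determinant"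
begin

unbundle no vec_syntax

text \<open>The coefficients of \<open>\<epsilon>\<^sub>t\<^sub>-\<^sub>1\<^sub>-\<^sub>k\<close> in the \<open>2n\<close> derivative processes form a vector
  \<open>u\<^sub>k = F\<^sup>k B\<close>. They decay geometrically, because \<open>1/a\<close> and \<open>1/c\<close> are holomorphic on a disc of
  radius larger than \<open>1\<close>; so the white noise property gives \<open>I = \<Sum>\<^sub>k u\<^sub>k u\<^sub>k\<^sup>T\<close>, and splitting off the
  term \<open>k = 0\<close> is the Stein equation. Powers of \<open>F\<close> tend to \<open>0\<close>, so this equation has only
  one solution, and the relations \<open>M F = G\<^sub>M M\<close> and \<open>M B = e\<^sub>P\<close> transport it to the equation for \<open>H\<close>.
  A vector with blocks \<open>p\<close>, \<open>q\<close> is in the kernel of \<open>I\<close> iff it is orthogonal to all \<open>u\<^sub>k\<close>, that is iff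
  \<open>p/a = q/c\<close> for the polynomials of degree \<open>< n\<close> with these coefficients. Such a pair
  other than \<open>(0, 0)\<close> exists iff the reversed polynomials have a common factor.\<close>

section \<open>Characteristic polynomials\<close>

text \<open>The reciprocals lose information. For n = 1 and a_1 = c_1 = 0 both are the constant 1,
  without common factor, yet I = B B^T is singular: the zero at the origin shared by the reversed
  polynomials is invisible to them. The degree bound n on p and q fits \<open>hat_poly\<close>,
  which has degree exactly n, whereas \<open>rec_poly\<close> reaches degree n only if its last
  coefficient is nonzero. Hence nonsingularity is characterised unconditionally through
  \<open>hat_poly\<close>, and through \<open>rec_poly\<close> under the guard that a_n or c_n is
  nonzero. The second obstacle is analytic: \<open>lag_filter\<close> is a pointwise
  \<open>suminf\<close>, meaningless where the series diverges. Almost sure convergence and the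
  exchange of sum and expectation both come from one random variable W, the series of r^k times the
  squared noise, with r a common decay rate. It is integrable, its convergence forces that of the
  filters, and a multiple of it dominates all products of partial sums.\<close>

lemma coeff_hat_poly:
  "coeff (hat_poly a) i = (if i \<le> dim_vec a then arma_coeff a (dim_vec a - i) else 0)"
proof -
  have "coeff (hat_poly a) i = (\<Sum>j\<le>dim_vec a. if j = dim_vec a - i \<and> i \<le> dim_vec a then arma_coeff a j else 0)"
    unfolding hat_poly_def coeff_sum coeff_monom by (intro sum.cong) auto
  also have "\<dots> = (if i \<le> dim_vec a then arma_coeff a (dim_vec a - i) else 0)"
    by (simp add: sum.delta)
  finally show ?thesis .
qed

lemma coeff_rec_poly:
  "coeff (rec_poly a) i = (if i \<le> dim_vec a then arma_coeff a i else 0)"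
  unfolding rec_poly_def coeff_sum coeff_monom by (simp add: sum.delta)

lemma degree_hat_poly: "degree (hat_poly a) = dim_vec a"
proof (rule antisym)
  show "degree (hat_poly a) \<le> dim_vec a"
    by (intro degree_le) (simp add: coeff_hat_poly)
  show "dim_vec a \<le> degree (hat_poly a)"
    by (intro le_degree) (simp add: coeff_hat_poly arma_coeff_def)
qed

lemma degree_rec_poly_le: "degree (rec_poly a) \<le> dim_vec a"
  by (intro degree_le) (simp add: coeff_rec_poly)

lemma coeff_rec_poly_0 [simp]: "coeff (rec_poly a) 0 = 1"
  by (simp add: coeff_rec_poly arma_coeff_def)

lemma rec_poly_nonzero [simp]: "rec_poly a \<noteq> 0"
  by (metis coeff_rec_poly_0 coeff_0 zero_neq_one)

lemma reflect_hat_poly: "reflect_poly (hat_poly a) = rec_poly a"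
  by (rule poly_eqI) (simp add: coeff_reflect_poly coeff_hat_poly coeff_rec_poly degree_hat_poly)

lemma poly_hat_poly:
  assumes "x \<noteq> 0"
  shows "poly (hat_poly a) x = x ^ dim_vec a * poly (rec_poly a) (inverse x)"
  using poly_reflect_poly_nz[of "inverse x" "hat_poly a"] assms
  by (simp add: reflect_hat_poly degree_hat_poly field_simps)

text \<open>Inversion carries a zero z of \<open>rec_poly a\<close> to a zero 1/z of
  \<open>hat_poly a\<close>; the case z = 0 is excluded by the constant coefficient 1.\<close>

lemma rec_poly_no_root:
  assumes "zeros_in_open_unit_disc (hat_poly a)" "poly (map_poly complex_of_real (rec_poly a)) z = 0"
  shows "norm z > 1"
proof -
  let ?h = "map_poly complex_of_real (hat_poly a)"
  have refl: "map_poly complex_of_real (rec_poly a) = reflect_poly ?h"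
    by (rule poly_eqI)
      (auto simp: coeff_reflect_poly coeff_map_poly coeff_hat_poly coeff_rec_poly degree_hat_poly degree_map_poly)
  have z: "z \<noteq> 0"
  proof
    assume "z = 0"
    then have "coeff (map_poly complex_of_real (rec_poly a)) 0 = 0"
      using assms(2) by (simp add: poly_0_coeff_0)
    then show False by (simp add: coeff_map_poly)
  qed
  then have "poly ?h (inverse z) = 0"
    using assms(2) poly_reflect_poly_nz[of z ?h] unfolding refl by simp
  then have "norm (inverse z) < 1"
    using assms(1) by (auto simp: zeros_in_open_unit_disc_def)
  then show ?thesis using z one_less_inverse[of "norm (inverse z)"]
    by (simp add: norm_inverse)
qed

text \<open>Zeros and radii of convergence live over the complex numbers, the filters over the
  reals. The embedded real inverse inverts the embedded polynomial, so by uniqueness it is the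
  complex inverse.\<close>

lemma fps_of_real_inverse_nth:
  fixes p :: "real poly"
  assumes "coeff p 0 \<noteq> 0"
  shows "fps_nth (inverse (fps_of_poly (map_poly complex_of_real p))) k
         = of_real (fps_nth (inverse (fps_of_poly p)) k)"
proof -
  define B where "B = Abs_fps (\<lambda>k. complex_of_real (fps_nth (inverse (fps_of_poly p)) k))"
  have "fps_of_poly (map_poly complex_of_real p) * B = 1"
  proof (rule fps_ext)
    fix m
    have "fps_nth (fps_of_poly (map_poly complex_of_real p) * B) m
        = of_real (fps_nth (fps_of_poly p * inverse (fps_of_poly p)) m)"
      by (simp add: fps_mult_nth B_def coeff_map_poly)
    also have "fps_of_poly p * inverse (fps_of_poly p) = 1"
      using assms by (intro inverse_mult_eq_1') simp
    finally show "fps_nth (fps_of_poly (map_poly complex_of_real p) * B) m = fps_nth 1 m"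
      by simp
  qed
  then have "inverse (fps_of_poly (map_poly complex_of_real p)) = B"
    by (metis fps_inverse_unique)
  then show ?thesis by (simp add: B_def)
qed

text \<open>The finitely many zeros have modulus above 1, so 1/a converges on a disc of some radius
  \<open>R\<close> above 1. At a point s strictly between 1 and \<open>R\<close> the terms of the
  series are bounded, which gives decay at rate 1/s.\<close>

lemma inverse_rec_poly_geometric:
  assumes "zeros_in_open_unit_disc (hat_poly a)"
  obtains C r where "0 < r" "r < 1" "0 \<le> C"
    "\<And>k. \<bar>fps_nth (inverse (fps_of_poly (rec_poly a))) k\<bar> \<le> C * r ^ k"
proof -
  define p where "p = map_poly complex_of_real (rec_poly a)"
  have p0: "coeff p 0 = 1" by (simp add: p_def coeff_map_poly)
  then have "p \<noteq> 0" by auto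
  \<comment> \<open>The entry 2 keeps the set nonempty when there are no zeros, as for a = 0; any
    number above 1 would serve.\<close>
  define Z where "Z = insert 2 (norm ` {z. poly p z = 0})"
  have "finite Z" using \<open>p \<noteq> 0\<close> by (simp add: Z_def poly_roots_finite)
  define R where "R = Min Z"
  have "R \<in> Z" unfolding R_def using \<open>finite Z\<close> by (intro Min_in) (auto simp: Z_def)
  then have "R > 1"
    using rec_poly_no_root[OF assms] by (auto simp: Z_def p_def)
  have nz: "poly p z \<noteq> 0" if "norm z < R" for z
  proof
    assume "poly p z = 0"
    then have "R \<le> norm z" unfolding R_def using \<open>finite Z\<close> by (intro Min_le) (auto simp: Z_def)
    then show False using that by simp
  qed
  have "fps_conv_radius (inverse (fps_of_poly p)) \<ge> min (ereal R) (fps_conv_radius (fps_of_poly p))"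
    by (rule fps_conv_radius_inverse) (use \<open>R > 1\<close> nz in \<open>auto simp: p0 zero_ereal_def\<close>)
  then have rad: "fps_conv_radius (inverse (fps_of_poly p)) \<ge> ereal R" by simp
  define s where "s = (1 + R) / 2"
  have s: "1 < s" "s < R" using \<open>R > 1\<close> by (auto simp: s_def)
  have "norm (complex_of_real s) < fps_conv_radius (inverse (fps_of_poly p))"
    using s rad less_le_trans[of "ereal s" "ereal R"] by simp
  then have "summable (\<lambda>k. fps_nth (inverse (fps_of_poly p)) k * of_real s ^ k)"
    by (rule summable_fps)
  then have "Bseq (\<lambda>k. fps_nth (inverse (fps_of_poly p)) k * of_real s ^ k)"
    using summable_LIMSEQ_zero convergent_imp_Bseq convergentI by metis
  then obtain C where C: "C > 0"
    "\<And>k. norm (fps_nth (inverse (fps_of_poly p)) k * of_real s ^ k) \<le> C"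
    by (auto simp: Bseq_def)
  show ?thesis
  proof (rule that[of "1 / s" C])
    fix k
    have "\<bar>fps_nth (inverse (fps_of_poly (rec_poly a))) k\<bar> * s ^ k \<le> C"
      using C(2)[of k] s
      by (simp add: p_def fps_of_real_inverse_nth norm_mult norm_power)
    then show "\<bar>fps_nth (inverse (fps_of_poly (rec_poly a))) k\<bar> \<le> C * (1 / s) ^ k"
      using s by (simp add: field_simps power_divide)
  qed (use s C in auto)
qed

section \<open>Common factors as polynomial relations of bounded degree\<close>

lemma common_factor_iff:
  fixes a c :: "real poly"
  assumes nz: "a \<noteq> 0" "c \<noteq> 0" and n: "n > 0" and deg: "max (degree a) (degree c) = n"
  shows "has_common_factor a c \<longleftrightarrow>
    (\<exists>p q. (p \<noteq> 0 \<or> q \<noteq> 0) \<and> degree p < n \<and> degree q < n \<and> p * c = q * a)"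
proof
  assume "has_common_factor a c"
  then obtain d p q where d: "degree d > 0" "a = d * p" "c = d * q"
    unfolding has_common_factor_def by (auto elim!: dvdE)
  then have "d \<noteq> 0" "p \<noteq> 0" "q \<noteq> 0" using nz by auto
  then have "degree p < n" "degree q < n" using d deg by (auto simp: degree_mult_eq)
  moreover have "p * c = q * a" using d by simp
  ultimately show "\<exists>p q. (p \<noteq> 0 \<or> q \<noteq> 0) \<and> degree p < n \<and> degree q < n \<and> p * c = q * a"
    using \<open>p \<noteq> 0\<close> by blast
next
  assume "\<exists>p q. (p \<noteq> 0 \<or> q \<noteq> 0) \<and> degree p < n \<and> degree q < n \<and> p * c = q * a"
  then obtain p q where pq: "p \<noteq> 0 \<or> q \<noteq> 0" "degree p < n" "degree q < n" "p * c = q * a" by blast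
  have nz': "p \<noteq> 0" "q \<noteq> 0" using pq nz by auto
  show "has_common_factor a c"
  proof (rule ccontr)
    assume no: "\<not> has_common_factor a c"
    have "coprime a c"
    proof (rule coprimeI)
      fix d assume d: "d dvd a" "d dvd c"
      then have "degree d = 0" using no unfolding has_common_factor_def by auto
      moreover have "d \<noteq> 0" using d nz by auto
      ultimately show "is_unit d" by (simp add: is_unit_iff_degree)
    qed
    moreover have "a dvd p * c" by (simp add: pq(4))
    moreover have "c dvd q * a" by (simp add: pq(4)[symmetric])
    ultimately have "a dvd p" "c dvd q"
      using coprime_dvd_mult_left_iff[of a c p] coprime_dvd_mult_left_iff[of c a q]
      by (auto simp: coprime_commute)
    \<comment> \<open>By \<open>deg\<close> one of the two left sides equals n, so p or q would be
      too large.\<close>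
    then have "degree a \<le> degree p" "degree c \<le> degree q"
      using nz' by (auto intro: dvd_imp_degree_le)
    then show False using pq(2,3) deg by auto
  qed
qed


text \<open>The reversal has a fixed length n, unlike \<open>reflect_poly\<close>, which depends on
  the degree and forgets powers of the variable. This makes it an involution on the polynomials of
  degree below n.\<close>

definition reversal :: "nat \<Rightarrow> real poly \<Rightarrow> real poly" where
  "reversal n p = (\<Sum>j<n. monom (coeff p (n - 1 - j)) j)"

lemma coeff_reversal: "coeff (reversal n p) j = (if j < n then coeff p (n - 1 - j) else 0)"
  unfolding reversal_def coeff_sum coeff_monom by (simp add: sum.delta)

lemma degree_reversal: "n > 0 \<Longrightarrow> degree (reversal n p) < n"
  by (rule le_less_trans[of _ "n - 1"], intro degree_le) (auto simp: coeff_reversal)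

lemma reversal_reversal: "degree p < n \<Longrightarrow> reversal n (reversal n p) = p"
  by (rule poly_eqI) (auto simp: coeff_reversal coeff_eq_0)

lemma poly_reversal:
  assumes "degree p < n" "x \<noteq> 0"
  shows "poly (reversal n p) x = x ^ (n - 1) * poly p (inverse x)"
proof -
  have "poly (reversal n p) x = (\<Sum>j<n. coeff p (n - 1 - j) * x ^ j)"
    by (simp add: reversal_def poly_sum poly_monom)
  also have "\<dots> = (\<Sum>j<n. coeff p j * x ^ (n - 1 - j))"
    by (rule sum.reindex_bij_witness[of _ "\<lambda>j. n - 1 - j" "\<lambda>j. n - 1 - j"]) auto
  also have "\<dots> = (\<Sum>j<n. x ^ (n - 1) * (coeff p j * inverse x ^ j))"
    using assms(2) by (intro sum.cong) (auto simp: power_diff field_simps)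
  also have "\<dots> = x ^ (n - 1) * (\<Sum>j<n. coeff p j * inverse x ^ j)"
    by (simp add: sum_distrib_left)
  also have "(\<Sum>j<n. coeff p j * inverse x ^ j) = poly p (inverse x)"
    unfolding poly_altdef using assms(1)
    by (intro sum.mono_neutral_right) (auto simp: coeff_eq_0)
  finally show ?thesis .
qed

text \<open>Multiplying by the variable forces agreement at 0 as well, and the factor can be
  cancelled afterwards.\<close>

lemma poly_eqI_nonzero:
  fixes p q :: "real poly"
  assumes "\<And>x. x \<noteq> 0 \<Longrightarrow> poly p x = poly q x"
  shows "p = q"
proof -
  have "monom 1 1 * p = monom 1 1 * q"
    by (rule poly_eq_poly_eq_iff[THEN iffD1], rule ext) (use assms in \<open>auto simp: poly_monom\<close>)
  then show ?thesis by (simp add: monom_eq_0_iff)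
qed

text \<open>At nonzero x both sides of the first equation are x^(2n-1) times those of the second at
  1/x: n - 1 powers come from \<open>reversal\<close> and n from \<open>hat_poly\<close>.\<close>

lemma reversal_hat_iff:
  assumes "dim_vec a = n" "dim_vec c = n" "degree p < n" "degree q < n"
  shows "reversal n p * hat_poly c = reversal n q * hat_poly a \<longleftrightarrow> p * rec_poly c = q * rec_poly a"
proof -
  have eval: "poly (reversal n p * hat_poly c) x = poly (reversal n q * hat_poly a) x \<longleftrightarrow>
        poly (p * rec_poly c) (inverse x) = poly (q * rec_poly a) (inverse x)" if "x \<noteq> 0" for x
    using that assms by (simp add: poly_reversal poly_hat_poly mult_ac)
  show ?thesis
  proof
    assume *: "reversal n p * hat_poly c = reversal n q * hat_poly a"
    show "p * rec_poly c = q * rec_poly a"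
      using eval[of "inverse _"] by (intro poly_eqI_nonzero) (simp add: *)
  next
    assume *: "p * rec_poly c = q * rec_poly a"
    show "reversal n p * hat_poly c = reversal n q * hat_poly a"
      using eval by (intro poly_eqI_nonzero) (simp add: *)
  qed
qed

text \<open>The kernel of the information matrix yields relations for \<open>rec_poly\<close>, but
  only \<open>hat_poly\<close> is sure to have degree n. Reversing p and q passes between the two
  and keeps nonzero pairs nonzero.\<close>

lemma hat_syzygy_iff:
  assumes "dim_vec a = n" "dim_vec c = n" "n > 0"
  shows "(\<exists>p q. (p \<noteq> 0 \<or> q \<noteq> 0) \<and> degree p < n \<and> degree q < n \<and> p * hat_poly c = q * hat_poly a)
     \<longleftrightarrow> (\<exists>p q. (p \<noteq> 0 \<or> q \<noteq> 0) \<and> degree p < n \<and> degree q < n \<and> p * rec_poly c = q * rec_poly a)"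
    (is "?L \<longleftrightarrow> ?R")
proof -
  have nz: "reversal n p \<noteq> 0" if "p \<noteq> 0" "degree p < n" for p
    using that reversal_reversal[of p n] by (auto simp: reversal_def)
  show ?thesis
  proof
    assume ?L
    then obtain p q where pq: "p \<noteq> 0 \<or> q \<noteq> 0" "degree p < n" "degree q < n"
      "p * hat_poly c = q * hat_poly a" by blast
    then have "reversal n p * rec_poly c = reversal n q * rec_poly a"
      using reversal_hat_iff[OF assms(1,2), of "reversal n p" "reversal n q"] assms(3)
      by (simp add: degree_reversal reversal_reversal)
    then show ?R using nz pq degree_reversal[OF assms(3)] by blast
  next
    assume ?R
    then obtain p q where pq: "p \<noteq> 0 \<or> q \<noteq> 0" "degree p < n" "degree q < n"
      "p * rec_poly c = q * rec_poly a" by blast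
    then have "reversal n p * hat_poly c = reversal n q * hat_poly a"
      using reversal_hat_iff[OF assms(1,2)] by simp
    then show ?L using nz pq degree_reversal[OF assms(3)] by blast
  qed
qed

section \<open>Linear processes driven by white noise\<close>

lemma white_noise_integrable_square:
  assumes wn: "gaussian_white_noise M \<sigma>2 \<epsilon>" and "\<sigma>2 > 0"
  shows "integrable M (\<lambda>\<omega>. (\<epsilon> s \<omega>)\<^sup>2)" "(\<integral>\<omega>. (\<epsilon> s \<omega>)\<^sup>2 \<partial>M) = \<sigma>2"
    "integrable M (\<epsilon> s)" "(\<integral>\<omega>. \<epsilon> s \<omega> \<partial>M) = 0"
proof -
  interpret prob_space M using wn by (simp add: gaussian_white_noise_def)
  have D: "distributed M lborel (\<epsilon> s) (normal_density 0 (sqrt \<sigma>2))"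
    using wn by (simp add: gaussian_white_noise_def)
  have pos: "0 < sqrt \<sigma>2" using assms(2) by simp
  show "(\<integral>\<omega>. \<epsilon> s \<omega> \<partial>M) = 0"
    by (rule normal_distributed_expectation[OF pos D])
  then show "(\<integral>\<omega>. (\<epsilon> s \<omega>)\<^sup>2 \<partial>M) = \<sigma>2"
    using normal_distributed_variance[OF pos D] assms(2) by simp
  show "integrable M (\<lambda>\<omega>. (\<epsilon> s \<omega>)\<^sup>2)"
    using integrable_normal_moment[OF pos, of 0 2]
    by (subst distributed_integrable[OF D, symmetric]) auto
  show "integrable M (\<epsilon> s)"
    using integrable_normal_moment[OF pos, of 0 1]
    by (subst distributed_integrable[OF D, of "\<lambda>x. x", symmetric]) auto
qed

lemma white_noise_covariance:
  assumes wn: "gaussian_white_noise M \<sigma>2 \<epsilon>" and "\<sigma>2 > 0"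
  shows "integrable M (\<lambda>\<omega>. \<epsilon> s \<omega> * \<epsilon> u \<omega>)"
    "(\<integral>\<omega>. \<epsilon> s \<omega> * \<epsilon> u \<omega> \<partial>M) = (if s = u then \<sigma>2 else 0)"
proof -
  interpret prob_space M using wn by (simp add: gaussian_white_noise_def)
  note sq = white_noise_integrable_square[OF assms]
  have "integrable M (\<lambda>\<omega>. \<epsilon> s \<omega> * \<epsilon> u \<omega>) \<and> (\<integral>\<omega>. \<epsilon> s \<omega> * \<epsilon> u \<omega> \<partial>M) = (if s = u then \<sigma>2 else 0)"
  proof (cases "s = u")
    case True
    then show ?thesis using sq by (simp add: power2_eq_square)
  next
    case False
    have "indep_vars (\<lambda>_. borel) \<epsilon> UNIV" using wn by (simp add: gaussian_white_noise_def)
    then have ind: "indep_vars (\<lambda>_. borel) \<epsilon> {s, u}" by (rule indep_vars_subset) simp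
    have "integrable M (\<lambda>\<omega>. \<Prod>i\<in>{s, u}. \<epsilon> i \<omega>)"
      by (rule indep_vars_integrable[OF _ ind]) (use sq in auto)
    moreover have "(\<integral>\<omega>. (\<Prod>i\<in>{s, u}. \<epsilon> i \<omega>) \<partial>M) = (\<Prod>i\<in>{s, u}. \<integral>\<omega>. \<epsilon> i \<omega> \<partial>M)"
      by (rule indep_vars_lebesgue_integral[OF _ ind]) (use sq in auto)
    ultimately show ?thesis using False sq by simp
  qed
  then show "integrable M (\<lambda>\<omega>. \<epsilon> s \<omega> * \<epsilon> u \<omega>)"
    "(\<integral>\<omega>. \<epsilon> s \<omega> * \<epsilon> u \<omega> \<partial>M) = (if s = u then \<sigma>2 else 0)" by auto
qed

text \<open>Cauchy-Schwarz after splitting r^k into two square roots, one of which stays with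
  \<open>e k\<close>. The bound does not depend on N, so it can serve in a dominated convergence
  argument.\<close>

lemma geometric_weighted_sum_square_le:
  fixes f e :: "nat \<Rightarrow> real"
  assumes r: "0 < r" "r < 1" and f: "\<And>k. \<bar>f k\<bar> \<le> C * r ^ k"
    and W: "summable (\<lambda>k. r ^ k * (e k)\<^sup>2)"
  shows "(\<Sum>k<N. f k * e k)\<^sup>2 \<le> C\<^sup>2 / (1 - r) * (\<Sum>k. r ^ k * (e k)\<^sup>2)"
proof -
  have sq: "C * (sqrt (r ^ k) * (sqrt (r ^ k) * \<bar>e k\<bar>)) = C * r ^ k * \<bar>e k\<bar>" for k
  proof -
    have "sqrt (r ^ k) * sqrt (r ^ k) = r ^ k" using r by simp
    then show ?thesis by (metis mult.assoc)
  qed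
  have "(\<Sum>k<N. f k * e k)\<^sup>2 \<le> (\<Sum>k<N. C * (sqrt (r ^ k) * (sqrt (r ^ k) * \<bar>e k\<bar>)))\<^sup>2"
  proof (rule power2_le_iff_abs_le[THEN iffD2])
    have C: "C * r ^ k \<ge> 0" for k using f[of k] by linarith
    show "0 \<le> (\<Sum>k<N. C * (sqrt (r ^ k) * (sqrt (r ^ k) * \<bar>e k\<bar>)))"
      unfolding sq by (intro sum_nonneg mult_nonneg_nonneg[OF C]) simp
    have "\<bar>\<Sum>k<N. f k * e k\<bar> \<le> (\<Sum>k<N. \<bar>f k * e k\<bar>)" by (rule sum_abs)
    also have "\<dots> \<le> (\<Sum>k<N. C * (sqrt (r ^ k) * (sqrt (r ^ k) * \<bar>e k\<bar>)))"
    proof (rule sum_mono)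
      fix k
      have "\<bar>f k * e k\<bar> \<le> C * r ^ k * \<bar>e k\<bar>"
        unfolding abs_mult by (rule mult_right_mono[OF f]) simp
      also have "\<dots> = C * (sqrt (r ^ k) * (sqrt (r ^ k) * \<bar>e k\<bar>))"
        by (rule sq[symmetric])
      finally show "\<bar>f k * e k\<bar> \<le> C * (sqrt (r ^ k) * (sqrt (r ^ k) * \<bar>e k\<bar>))" .
    qed
    finally show "\<bar>\<Sum>k<N. f k * e k\<bar> \<le> (\<Sum>k<N. C * (sqrt (r ^ k) * (sqrt (r ^ k) * \<bar>e k\<bar>)))" .
  qed
  also have "\<dots> = C\<^sup>2 * (\<Sum>k<N. sqrt (r ^ k) * (sqrt (r ^ k) * \<bar>e k\<bar>))\<^sup>2"
    by (simp add: sum_distrib_left[symmetric] power_mult_distrib)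
  also have "\<dots> \<le> C\<^sup>2 * ((\<Sum>k<N. (sqrt (r ^ k))\<^sup>2) * (\<Sum>k<N. (sqrt (r ^ k) * \<bar>e k\<bar>)\<^sup>2))"
    by (intro mult_left_mono Cauchy_Schwarz_ineq_sum) simp
  also have "\<dots> = C\<^sup>2 * ((\<Sum>k<N. r ^ k) * (\<Sum>k<N. r ^ k * (e k)\<^sup>2))"
    using r by (simp add: power_mult_distrib)
  also have "\<dots> \<le> C\<^sup>2 * ((1 / (1 - r)) * (\<Sum>k. r ^ k * (e k)\<^sup>2))"
  proof (intro mult_left_mono mult_mono)
    have "(\<Sum>k<N. r ^ k) \<le> (\<Sum>k. r ^ k)"
      using r by (intro sum_le_suminf summable_geometric) auto
    then show "(\<Sum>k<N. r ^ k) \<le> 1 / (1 - r)"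
      using r by (simp add: suminf_geometric)
    show "(\<Sum>k<N. r ^ k * (e k)\<^sup>2) \<le> (\<Sum>k. r ^ k * (e k)\<^sup>2)"
      using r by (intro sum_le_suminf W) auto
  qed (use r in \<open>auto intro: sum_nonneg\<close>)
  finally show ?thesis by simp
qed

text \<open>The weighted squares control the plain series because |e| is at most 1 + e^2.\<close>

lemma geometric_weighted_summable:
  fixes f e :: "nat \<Rightarrow> real"
  assumes r: "0 < r" "r < 1" and f: "\<And>k. \<bar>f k\<bar> \<le> C * r ^ k"
    and W: "summable (\<lambda>k. r ^ k * (e k)\<^sup>2)"
  shows "summable (\<lambda>k. f k * e k)"
proof (rule summable_comparison_test)
  have *: "norm (f k * e k) \<le> C * r ^ k + C * (r ^ k * (e k)\<^sup>2)" for k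
  proof -
    have C: "C * r ^ k \<ge> 0" using f[of k] by linarith
    have "0 \<le> (\<bar>e k\<bar> - 1)\<^sup>2" by simp
    then have "\<bar>e k\<bar> \<le> 1 + (e k)\<^sup>2" by (simp add: power2_eq_square algebra_simps) 
    then have "C * r ^ k * \<bar>e k\<bar> \<le> C * r ^ k * (1 + (e k)\<^sup>2)"
      using C by (rule mult_left_mono)
    moreover have "norm (f k * e k) \<le> C * r ^ k * \<bar>e k\<bar>"
      unfolding real_norm_def abs_mult by (rule mult_right_mono[OF f]) simp
    ultimately show ?thesis by (simp add: algebra_simps)
  qed
  then show "\<exists>N. \<forall>k\<ge>N. norm (f k * e k) \<le> C * r ^ k + C * (r ^ k * (e k)\<^sup>2)" by blast
  show "summable (\<lambda>k. C * r ^ k + C * (r ^ k * (e k)\<^sup>2))"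
    using r by (intro summable_add summable_mult summable_geometric W) auto
qed

text \<open>The expectation of this nonnegative series is v times a geometric series, hence finite,
  so the series itself is finite almost surely. The exceptional null set involves no filter and
  therefore serves all filters of rate r at once.\<close>

lemma geometric_weighted_square_summable:
  fixes x :: "nat \<Rightarrow> 'w \<Rightarrow> real"
  assumes r: "0 < r" "r < 1"
    and int: "\<And>k. integrable M (\<lambda>\<omega>. (x k \<omega>)\<^sup>2)" and var: "\<And>k. (\<integral>\<omega>. (x k \<omega>)\<^sup>2 \<partial>M) = v"
  shows "AE \<omega> in M. summable (\<lambda>k. r ^ k * (x k \<omega>)\<^sup>2)"
    "integrable M (\<lambda>\<omega>. \<Sum>k. r ^ k * (x k \<omega>)\<^sup>2)"
proof -
  have v: "v \<ge> 0" unfolding var[of 0, symmetric] by (rule Bochner_Integration.integral_nonneg) simp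
  have nn: "(\<integral>\<^sup>+\<omega>. ennreal (r ^ k * (x k \<omega>)\<^sup>2) \<partial>M) = ennreal (r ^ k * v)" for k
    using r by (subst nn_integral_eq_integral) (auto simp: int var)
  have meas: "(\<lambda>\<omega>. ennreal (r ^ k * (x k \<omega>)\<^sup>2)) \<in> borel_measurable M" for k
    by (intro measurable_compose[OF _ measurable_ennreal] borel_measurable_times borel_measurable_const
        borel_measurable_integrable[OF int])
  have "(\<integral>\<^sup>+\<omega>. (\<Sum>k. ennreal (r ^ k * (x k \<omega>)\<^sup>2)) \<partial>M) = (\<Sum>k. ennreal (r ^ k * v))"
    by (subst nn_integral_suminf[OF meas]) (simp add: nn)
  also have "\<dots> < \<infinity>"
  proof -
    have "summable (\<lambda>k. r ^ k * v)" using r by (intro summable_mult2 summable_geometric) simp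
    then show ?thesis using r v by (subst suminf_ennreal2) auto
  qed
  finally have fin: "(\<integral>\<^sup>+\<omega>. (\<Sum>k. ennreal (r ^ k * (x k \<omega>)\<^sup>2)) \<partial>M) \<noteq> \<infinity>" by simp
  have "AE \<omega> in M. (\<Sum>k. ennreal (r ^ k * (x k \<omega>)\<^sup>2)) \<noteq> \<infinity>"
    by (rule nn_integral_PInf_AE[OF borel_measurable_suminf_order[OF meas] fin])
  then show *: "AE \<omega> in M. summable (\<lambda>k. r ^ k * (x k \<omega>)\<^sup>2)"
  proof eventually_elim
    fix \<omega> assume "(\<Sum>k. ennreal (r ^ k * (x k \<omega>)\<^sup>2)) \<noteq> \<infinity>"
    then show "summable (\<lambda>k. r ^ k * (x k \<omega>)\<^sup>2)"
      using r by (intro summable_suminf_not_top) auto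
  qed
  show "integrable M (\<lambda>\<omega>. \<Sum>k. r ^ k * (x k \<omega>)\<^sup>2)"
  proof (rule integrable_suminf)
    show "AE \<omega> in M. summable (\<lambda>k. norm (r ^ k * (x k \<omega>)\<^sup>2))"
      using * by eventually_elim (use r in simp)
    show "summable (\<lambda>k. \<integral>\<omega>. norm (r ^ k * (x k \<omega>)\<^sup>2) \<partial>M)"
      using r by (simp add: var summable_mult2 summable_geometric)
  qed (simp add: int)
qed

lemma geometric_product_summable:
  fixes f g :: "nat \<Rightarrow> real"
  assumes r: "0 < r" "r < 1" and f: "\<And>k. \<bar>f k\<bar> \<le> C * r ^ k" and g: "\<And>k. \<bar>g k\<bar> \<le> C * r ^ k"
  shows "summable (\<lambda>k. f k * g k)"
  proof (rule summable_comparison_test)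
    have "norm (f k * g k) \<le> C\<^sup>2 * (r\<^sup>2) ^ k" for k
    proof -
      have "norm (f k * g k) \<le> (C * r ^ k) * (C * r ^ k)"
        unfolding real_norm_def abs_mult using f[of k] g[of k] by (intro mult_mono) auto
      then show ?thesis by (simp add: power2_eq_square power_mult_distrib mult_ac)
    qed
    then show "\<exists>N. \<forall>k\<ge>N. norm (f k * g k) \<le> C\<^sup>2 * (r\<^sup>2) ^ k" by blast
    show "summable (\<lambda>k. C\<^sup>2 * (r\<^sup>2) ^ k)"
      using r by (intro summable_mult summable_geometric) (simp add: abs_square_less_1)
  qed

text \<open>For partial sums the covariance leaves only the diagonal terms. Dominated convergence
  passes to the limit, the dominating function being a multiple of \<open>W\<close>.\<close>

lemma integral_linear_process_product:
  fixes x :: "nat \<Rightarrow> 'w \<Rightarrow> real"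
  assumes r: "0 < r" "r < 1"
    and f: "\<And>k. \<bar>f k\<bar> \<le> C * r ^ k" and g: "\<And>k. \<bar>g k\<bar> \<le> C * r ^ k"
    and meas: "\<And>k. x k \<in> borel_measurable M"
    and int: "\<And>k l. integrable M (\<lambda>\<omega>. x k \<omega> * x l \<omega>)"
    and cov: "\<And>k l. (\<integral>\<omega>. x k \<omega> * x l \<omega> \<partial>M) = (if k = l then v else 0)"
  shows "(\<integral>\<omega>. (\<Sum>k. f k * x k \<omega>) * (\<Sum>k. g k * x k \<omega>) \<partial>M) = v * (\<Sum>k. f k * g k)"
proof -
  have int2: "integrable M (\<lambda>\<omega>. (x k \<omega>)\<^sup>2)" "(\<integral>\<omega>. (x k \<omega>)\<^sup>2 \<partial>M) = v" for k
    using int[of k k] cov[of k k] by (simp_all add: power2_eq_square)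
  define W where "W = (\<lambda>\<omega>. \<Sum>k. r ^ k * (x k \<omega>)\<^sup>2)"
  note AE = geometric_weighted_square_summable(1)[OF r int2]
  have Wint: "integrable M W"
    unfolding W_def by (rule geometric_weighted_square_summable(2)[OF r int2])
  let ?X = "\<lambda>N \<omega>. (\<Sum>k<N. f k * x k \<omega>)" and ?Y = "\<lambda>N \<omega>. (\<Sum>k<N. g k * x k \<omega>)"
  have "(\<lambda>N. \<integral>\<omega>. ?X N \<omega> * ?Y N \<omega> \<partial>M)
      \<longlonglongrightarrow> (\<integral>\<omega>. (\<Sum>k. f k * x k \<omega>) * (\<Sum>k. g k * x k \<omega>) \<partial>M)"
  proof (rule integral_dominated_convergence)
    show "integrable M (\<lambda>\<omega>. C\<^sup>2 / (1 - r) * W \<omega>)" using Wint by simp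
    show "AE \<omega> in M. (\<lambda>N. ?X N \<omega> * ?Y N \<omega>) \<longlonglongrightarrow> (\<Sum>k. f k * x k \<omega>) * (\<Sum>k. g k * x k \<omega>)"
      using AE by eventually_elim
        (intro tendsto_mult summable_LIMSEQ geometric_weighted_summable[OF r f] geometric_weighted_summable[OF r g])
    show "AE \<omega> in M. norm (?X N \<omega> * ?Y N \<omega>) \<le> C\<^sup>2 / (1 - r) * W \<omega>" for N
      using AE
    proof eventually_elim
      fix \<omega> assume elim: "summable (\<lambda>k. r ^ k * (x k \<omega>)\<^sup>2)"
      \<comment> \<open>The inequality 2|XY| <= X^2 + Y^2 reduces the product to the uniform bound
        on each square.\<close>
      have "norm (?X N \<omega> * ?Y N \<omega>) \<le> ((?X N \<omega>)\<^sup>2 + (?Y N \<omega>)\<^sup>2) / 2"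
        using sum_squares_bound[of "\<bar>?X N \<omega>\<bar>" "\<bar>?Y N \<omega>\<bar>"] by (simp add: abs_mult)
      also have "\<dots> \<le> C\<^sup>2 / (1 - r) * W \<omega>"
      proof -
        have half: "(p + q) / 2 \<le> z" if "p \<le> z" "q \<le> z" for p q z :: real using that by simp
        show ?thesis unfolding W_def
          by (intro half geometric_weighted_sum_square_le[OF r f elim] geometric_weighted_sum_square_le[OF r g elim])
      qed
      finally show "norm (?X N \<omega> * ?Y N \<omega>) \<le> C\<^sup>2 / (1 - r) * W \<omega>" .
    qed
    show "(\<lambda>\<omega>. ?X N \<omega> * ?Y N \<omega>) \<in> borel_measurable M" for N
      using meas by measurable
    show "(\<lambda>\<omega>. (\<Sum>k. f k * x k \<omega>) * (\<Sum>k. g k * x k \<omega>)) \<in> borel_measurable M"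
      using meas by measurable
  qed
  moreover have "(\<integral>\<omega>. ?X N \<omega> * ?Y N \<omega> \<partial>M) = (\<Sum>k<N. v * (f k * g k))" for N
  proof -
    have "(\<integral>\<omega>. ?X N \<omega> * ?Y N \<omega> \<partial>M)
        = (\<integral>\<omega>. (\<Sum>k<N. \<Sum>l<N. f k * g l * (x k \<omega> * x l \<omega>)) \<partial>M)"
      unfolding sum_product by (intro Bochner_Integration.integral_cong refl sum.cong) simp
    also have "\<dots> = (\<Sum>k<N. \<Sum>l<N. f k * g l * (if k = l then v else 0))"
      by (simp add: int cov)
    also have "\<dots> = (\<Sum>k<N. v * (f k * g k))"
      by (intro sum.cong refl) (simp add: if_distrib sum.delta' mult_ac cong: if_cong)
    finally show ?thesis .
  qed
  moreover have "(\<lambda>N. \<Sum>k<N. v * (f k * g k)) \<longlonglongrightarrow> v * (\<Sum>k. f k * g k)"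
    unfolding sum_distrib_left[symmetric] by (intro tendsto_mult_left summable_LIMSEQ geometric_product_summable[OF r f g])
  ultimately show ?thesis by (simp add: LIMSEQ_unique)
qed

section \<open>Stein equations and Gram matrices\<close>

lemma outer_prod_mult_vec:
  assumes "A \<in> carrier_mat m n" "b \<in> carrier_vec n"
  shows "outer_prod (A *\<^sub>v b) (A *\<^sub>v b) = A * outer_prod b b * transpose_mat A"
proof (rule eq_matI)
  fix i j assume "i < dim_row (A * outer_prod b b * transpose_mat A)" "j < dim_col (A * outer_prod b b * transpose_mat A)"
  then have "i < m" "j < m" using assms by auto
  then show "outer_prod (A *\<^sub>v b) (A *\<^sub>v b) $$ (i, j) = (A * outer_prod b b * transpose_mat A) $$ (i, j)"
    using assms
    by (simp add: outer_prod_def scalar_prod_def sum_product sum_distrib_left sum_distrib_right)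
      (subst sum.swap, intro sum.cong refl, simp)
qed (use assms in \<open>auto simp: outer_prod_def\<close>)

lemma outer_prod_carrier [simp]:
  "u \<in> carrier_vec m \<Longrightarrow> v \<in> carrier_vec n \<Longrightarrow> outer_prod u v \<in> carrier_mat m n"
  by (simp add: outer_prod_def carrier_vecD)

text \<open>After multiplication by T on the left and its transpose on the right, T F = G T moves T
  next to X. This is applied with \<open>M_mat\<close> and, in the opposite direction, with
  \<open>M_inv\<close>.\<close>

lemma stein_solution_conjugate:
  assumes F: "F \<in> carrier_mat N N" and G: "G \<in> carrier_mat N N"
    and T: "T \<in> carrier_mat N N" and U: "U \<in> carrier_mat N N"
    and TU: "T * U = 1\<^sub>m N" "U * T = 1\<^sub>m N"
    and conj: "T * F = G * T" and b: "b \<in> carrier_vec N" "T *\<^sub>v b = d"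
    and X: "stein_solution F b X"
  shows "stein_solution G d (T * X * transpose_mat T)"
proof -
  have Xc: "X \<in> carrier_mat N N" and XF: "X = F * X * transpose_mat F + outer_prod b b"
    using X b unfolding stein_solution_def by auto
  have ob: "outer_prod b b \<in> carrier_mat N N" using b by simp
  have d: "d \<in> carrier_vec N" using b T by auto
  have "T * X * transpose_mat T = T * (F * X * transpose_mat F) * transpose_mat T + T * outer_prod b b * transpose_mat T"
    using T F Xc ob
    by (subst XF) (simp add: mult_add_distrib_mat[of _ N N _ N] add_mult_distrib_mat[of _ N N _ _ N])
  also have "T * outer_prod b b * transpose_mat T = outer_prod d d"
    using outer_prod_mult_vec[OF T b(1)] b(2) by simp
  also have "T * (F * X * transpose_mat F) * transpose_mat T = (T * F) * X * transpose_mat (T * F)"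
    using T F Xc by (simp add: transpose_mult[of _ N N _ N] assoc_mult_mat[of _ N N _ N _ N])
  also have "\<dots> = G * (T * X * transpose_mat T) * transpose_mat G"
    unfolding conj using T G Xc by (simp add: transpose_mult[of _ N N _ N] assoc_mult_mat[of _ N N _ N _ N])
  finally show ?thesis
    using d T Xc unfolding stein_solution_def by auto
qed

text \<open>The constant terms cancel in the difference D of two solutions, so D = A D A^T.
  Iterating gives D = A^k D (A^k)^T for every k, where the right side tends to 0.\<close>

lemma stein_solution_unique:
  assumes A: "A \<in> carrier_mat N N" and b: "b \<in> carrier_vec N"
    and lim: "\<And>i j. i < N \<Longrightarrow> j < N \<Longrightarrow> (\<lambda>k. (A ^\<^sub>m k) $$ (i, j)) \<longlonglongrightarrow> 0"
    and X: "stein_solution A b X" and Y: "stein_solution A b Y"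
  shows "X = Y"
proof -
  have Xc: "X \<in> carrier_mat N N" and XA: "X = A * X * transpose_mat A + outer_prod b b"
    using X b unfolding stein_solution_def by auto
  have Yc: "Y \<in> carrier_mat N N" and YA: "Y = A * Y * transpose_mat A + outer_prod b b"
    using Y b unfolding stein_solution_def by auto
  define D where "D = X - Y"
  have Dc: "D \<in> carrier_mat N N" unfolding D_def by (rule minus_carrier_mat[OF Yc])
  have ob: "outer_prod b b \<in> carrier_mat N N" using b by simp
  have "D = (A * X * transpose_mat A + outer_prod b b) - (A * Y * transpose_mat A + outer_prod b b)"
    using XA YA by (simp add: D_def)
  also have "\<dots> = A * X * transpose_mat A - A * Y * transpose_mat A"
    using A Xc Yc ob by (intro eq_matI) auto
  also have "\<dots> = A * D * transpose_mat A"
    using A Xc Yc unfolding D_def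
    by (simp add: mult_minus_distrib_mat[of _ N N _ N] minus_mult_distrib_mat[of _ N N _ _ N])
  finally have D1: "D = A * D * transpose_mat A" .
  have Ak: "A ^\<^sub>m k \<in> carrier_mat N N" for k using A by simp
  have Dk: "D = (A ^\<^sub>m k) * D * transpose_mat (A ^\<^sub>m k)" for k
  proof (induction k)
    case 0
    then show ?case using A Dc by simp
  next
    case (Suc k)
    have "D = (A ^\<^sub>m k) * (A * D * transpose_mat A) * transpose_mat (A ^\<^sub>m k)"
      using Suc D1 by simp
    also have "\<dots> = (A ^\<^sub>m k * A) * D * transpose_mat (A ^\<^sub>m k * A)"
      using A Ak[of k] Dc by (simp add: transpose_mult[of _ N N _ N] assoc_mult_mat[of _ N N _ N _ N])
    finally show ?case by simp
  qed
  have "D $$ (i, j) = 0" if ij: "i < N" "j < N" for i j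
  proof -
    have "D $$ (i, j) = (\<Sum>l<N. (A ^\<^sub>m k) $$ (i, l) * (\<Sum>m<N. D $$ (l, m) * (A ^\<^sub>m k) $$ (j, m)))" for k
    proof -
      obtain Q where Q: "Q = A ^\<^sub>m k" by simp
      have Qc: "Q \<in> carrier_mat N N" and DQ: "D = Q * D * transpose_mat Q"
        using Ak[of k] Dk[of k] by (simp_all only: Q)
      show ?thesis
        unfolding Q[symmetric] using ij Dc Qc by (subst DQ) (simp add: scalar_prod_def atLeast0LessThan)
    qed
    moreover have "(\<lambda>k. \<Sum>l<N. (A ^\<^sub>m k) $$ (i, l) * (\<Sum>m<N. D $$ (l, m) * (A ^\<^sub>m k) $$ (j, m))) \<longlonglongrightarrow>
        (\<Sum>l<N. 0 * (\<Sum>m<N. D $$ (l, m) * 0))"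
      using ij by (intro tendsto_sum tendsto_mult lim tendsto_const) auto
    ultimately show ?thesis by (simp add: LIMSEQ_const_iff)
  qed
  then have "X $$ (i, j) = Y $$ (i, j)" if "i < N" "j < N" for i j
    using that Xc Yc by (auto simp: D_def)
  then show ?thesis using Xc Yc by (intro eq_matI) auto
qed

section \<open>Gram matrices of vector sequences\<close>

lemma outer_prod_dim [simp]: "dim_row (outer_prod u v) = dim_vec u" "dim_col (outer_prod u v) = dim_vec v"
  by (simp_all add: outer_prod_def)

lemma e_vec_dim [simp]: "dim_vec (e_vec n) = n"
  by (simp add: e_vec_def)

lemma mult_mat_vec_uminus:
  assumes "A \<in> carrier_mat m n" "v \<in> carrier_vec n"
  shows "A *\<^sub>v (- v) = - (A *\<^sub>v v :: real vec)"
  using assms by (intro eq_vecI) auto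

text \<open>For u_k = A^k b this is the controllability Gramian of the pair (A, b). The entries are
  \<open>suminf\<close> values, so the main facts below assume that the products are
  summable.\<close>

definition gram_mat :: "nat \<Rightarrow> (nat \<Rightarrow> real vec) \<Rightarrow> real mat" where
  "gram_mat N u = Matrix.mat N N (\<lambda>(i, j). \<Sum>k. u k $ i * u k $ j)"

lemma gram_mat_carrier [simp]: "gram_mat N u \<in> carrier_mat N N"
  by (simp add: gram_mat_def)

text \<open>Since A u_k = u_(k+1), conjugating by A shifts the series by one index, and only the
  term b b^T at k = 0 is lost.\<close>

lemma stein_solution_gram_mat:
  assumes A: "A \<in> carrier_mat N N" and b: "b \<in> carrier_vec N" and u: "\<And>k. u k \<in> carrier_vec N"
    and u0: "u 0 = b" and step: "\<And>k. u (Suc k) = A *\<^sub>v u k"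
    and sm: "\<And>i j. i < N \<Longrightarrow> j < N \<Longrightarrow> summable (\<lambda>k. u k $ i * u k $ j)"
  shows "stein_solution A b (gram_mat N u)"
proof -
  have "gram_mat N u = A * gram_mat N u * transpose_mat A + outer_prod b b"
  proof (rule eq_matI)
    fix i j assume "i < dim_row (A * gram_mat N u * transpose_mat A + outer_prod b b)"
      "j < dim_col (A * gram_mat N u * transpose_mat A + outer_prod b b)"
    then have ij: "i < N" "j < N" using b by (auto simp: outer_prod_def)
    have "(A * gram_mat N u * transpose_mat A) $$ (i, j)
        = (\<Sum>m<N. (\<Sum>l<N. A $$ (i, l) * (\<Sum>k. u k $ l * u k $ m)) * A $$ (j, m))"
      using ij A by (simp add: scalar_prod_def atLeast0LessThan gram_mat_def)
    also have "\<dots> = (\<Sum>m<N. \<Sum>l<N. \<Sum>k. A $$ (i, l) * A $$ (j, m) * (u k $ l * u k $ m))"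
      unfolding sum_distrib_right
      by (intro sum.cong refl) (subst suminf_mult[OF sm], auto)
    also have "\<dots> = (\<Sum>k. \<Sum>m<N. \<Sum>l<N. A $$ (i, l) * A $$ (j, m) * (u k $ l * u k $ m))"
    proof -
      have s1: "summable (\<lambda>k. A $$ (i, l) * A $$ (j, m) * (u k $ l * u k $ m))" if "l < N" "m < N" for l m
        using that by (intro summable_mult sm)
      have s2: "summable (\<lambda>k. \<Sum>l<N. A $$ (i, l) * A $$ (j, m) * (u k $ l * u k $ m))" if "m < N" for m
        using that by (intro summable_sum s1) auto
      have "(\<Sum>k. \<Sum>m<N. \<Sum>l<N. A $$ (i, l) * A $$ (j, m) * (u k $ l * u k $ m))
          = (\<Sum>m<N. \<Sum>k. \<Sum>l<N. A $$ (i, l) * A $$ (j, m) * (u k $ l * u k $ m))"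
        using s2 by (intro suminf_sum) auto
      also have "\<dots> = (\<Sum>m<N. \<Sum>l<N. \<Sum>k. A $$ (i, l) * A $$ (j, m) * (u k $ l * u k $ m))"
        using s1 by (intro sum.cong refl suminf_sum) auto
      finally show ?thesis by simp
    qed
    also have "\<dots> = (\<Sum>k. u (Suc k) $ i * u (Suc k) $ j)"
    proof (rule suminf_cong)
      fix k
      have uk: "dim_vec (u k) = N" using u by auto
      have "u (Suc k) $ i * u (Suc k) $ j = (\<Sum>l<N. A $$ (i, l) * u k $ l) * (\<Sum>m<N. A $$ (j, m) * u k $ m)"
        using ij A uk unfolding step by (simp add: scalar_prod_def atLeast0LessThan)
      also have "\<dots> = (\<Sum>m<N. \<Sum>l<N. A $$ (i, l) * A $$ (j, m) * (u k $ l * u k $ m))"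
        unfolding sum_product by (subst sum.swap) (simp add: mult_ac)
      finally show "(\<Sum>m<N. \<Sum>l<N. A $$ (i, l) * A $$ (j, m) * (u k $ l * u k $ m)) = u (Suc k) $ i * u (Suc k) $ j"
        by simp
    qed
    also have "\<dots> = (\<Sum>k. u k $ i * u k $ j) - u 0 $ i * u 0 $ j"
      using suminf_split_head[OF sm[OF ij]] by simp
    finally show "gram_mat N u $$ (i, j) = (A * gram_mat N u * transpose_mat A + outer_prod b b) $$ (i, j)"
      using ij A b by (simp add: gram_mat_def outer_prod_def u0)
  qed (use A b in \<open>auto simp: outer_prod_def gram_mat_def\<close>)
  then show ?thesis using b by (simp add: stein_solution_def carrier_vecD)
qed

text \<open>Pairing the kernel equation with v gives the sum over k of the squared inner products of
  u_k and v; a series of squares with sum 0 has only zero terms.\<close>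

lemma gram_mat_kernel:
  assumes v: "v \<in> carrier_vec N"
    and sm: "\<And>i j. i < N \<Longrightarrow> j < N \<Longrightarrow> summable (\<lambda>k. u k $ i * u k $ j)"
  shows "gram_mat N u *\<^sub>v v = 0\<^sub>v N \<longleftrightarrow> (\<forall>k. (\<Sum>i<N. u k $ i * v $ i) = 0)"
proof
  have sm': "summable (\<lambda>k. u k $ i * u k $ j * z)" if "i < N" "j < N" for i j z
    using sm that by (intro summable_mult2) auto
  have entry: "(gram_mat N u *\<^sub>v v) $ i = (\<Sum>k. u k $ i * (\<Sum>j<N. u k $ j * v $ j))" if i: "i < N" for i
  proof -
    have "(gram_mat N u *\<^sub>v v) $ i = (\<Sum>j<N. \<Sum>k. u k $ i * u k $ j * v $ j)"
      using i v sm by (simp add: gram_mat_def scalar_prod_def atLeast0LessThan suminf_mult2)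
    also have "\<dots> = (\<Sum>k. \<Sum>j<N. u k $ i * u k $ j * v $ j)"
      using i sm' by (subst suminf_sum) auto
    finally show ?thesis by (simp add: sum_distrib_left mult_ac)
  qed
  show "gram_mat N u *\<^sub>v v = 0\<^sub>v N" if "\<forall>k. (\<Sum>i<N. u k $ i * v $ i) = 0"
    using that by (intro eq_vecI) (auto simp: entry simp del: index_mult_mat_vec, simp add: gram_mat_def)
  assume ker: "gram_mat N u *\<^sub>v v = 0\<^sub>v N"
  have sq: "(\<Sum>i<N. v $ i * (u k $ i * (\<Sum>j<N. u k $ j * v $ j))) = (\<Sum>i<N. u k $ i * v $ i)\<^sup>2" for k
    unfolding power2_eq_square sum_distrib_right by (intro sum.cong) auto
  have smi: "summable (\<lambda>k. v $ i * (u k $ i * (\<Sum>j<N. u k $ j * v $ j)))" if "i < N" for i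
    unfolding sum_distrib_left mult.assoc[symmetric] using that sm
    by (intro summable_sum summable_mult2) (simp add: mult.assoc summable_mult)
  have "0 = (\<Sum>i<N. v $ i * (\<Sum>k. u k $ i * (\<Sum>j<N. u k $ j * v $ j)))"
    using ker entry by (metis (no_types, lifting) index_zero_vec(1) lessThan_iff mult_zero_right sum.neutral)
  also have "\<dots> = (\<Sum>i<N. \<Sum>k. v $ i * (u k $ i * (\<Sum>j<N. u k $ j * v $ j)))"
  proof (intro sum.cong refl)
    fix i assume "i \<in> {..<N}"
    then have "summable (\<lambda>k. u k $ i * (\<Sum>j<N. u k $ j * v $ j))"
      unfolding sum_distrib_left mult.assoc[symmetric] using sm' by (intro summable_sum) auto
    then show "v $ i * (\<Sum>k. u k $ i * (\<Sum>j<N. u k $ j * v $ j)) = (\<Sum>k. v $ i * (u k $ i * (\<Sum>j<N. u k $ j * v $ j)))"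
      by (simp add: suminf_mult)
  qed
  also have "\<dots> = (\<Sum>k. (\<Sum>i<N. u k $ i * v $ i)\<^sup>2)"
    using smi by (subst suminf_sum[symmetric]) (auto simp: sq)
  finally have z: "(\<Sum>k. (\<Sum>i<N. u k $ i * v $ i)\<^sup>2) = 0" by simp
  have "summable (\<lambda>k. (\<Sum>i<N. u k $ i * v $ i)\<^sup>2)"
    unfolding sq[symmetric] using smi by (intro summable_sum) auto
  then show "\<forall>k. (\<Sum>i<N. u k $ i * v $ i) = 0"
    using z by (subst (asm) suminf_eq_zero_iff) auto
qed

lemma invertible_mat_iff_kernel:
  fixes K :: "'a :: field mat"
  assumes K: "K \<in> carrier_mat N N"
  shows "invertible_mat K \<longleftrightarrow> (\<forall>v\<in>carrier_vec N. K *\<^sub>v v = 0\<^sub>v N \<longrightarrow> v = 0\<^sub>v N)"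
proof
  assume "invertible_mat K"
  then obtain L where L: "K * L = 1\<^sub>m N" "L * K = 1\<^sub>m (dim_row L)"
    using K by (auto simp: invertible_mat_def inverts_mat_def)
  \<comment> \<open>\<open>invertible_mat\<close> does not fix the shape of the inverse; the column
    counts of the two products determine it.\<close>
  then have "dim_col L = N" "dim_row L = N"
    using K by (metis carrier_matD(2) index_mult_mat(3) index_one_mat(3))+
  then have Lc: "L \<in> carrier_mat N N" by auto
  show "\<forall>v\<in>carrier_vec N. K *\<^sub>v v = 0\<^sub>v N \<longrightarrow> v = 0\<^sub>v N"
  proof safe
    fix v assume v: "v \<in> carrier_vec N" "K *\<^sub>v v = 0\<^sub>v N"
    have "v = (L * K) *\<^sub>v v" using L(2) v Lc by simp
    also have "\<dots> = L *\<^sub>v (K *\<^sub>v v)" using Lc K v by simp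
    also have "\<dots> = 0\<^sub>v N" using v(2) Lc by (intro eq_vecI) (auto simp: scalar_prod_def)
    finally show "v = 0\<^sub>v N" .
  qed
next
  assume "\<forall>v\<in>carrier_vec N. K *\<^sub>v v = 0\<^sub>v N \<longrightarrow> v = 0\<^sub>v N"
  then have "Determinant.det K \<noteq> 0" using det_0_iff_vec_prod_zero_field[OF K] by blast
  then have "K \<in> Units (ring_mat TYPE('a) N ())" by (rule det_non_zero_imp_unit[OF K])
  then show "invertible_mat K"
    using K by (auto simp: Units_def ring_mat_simps invertible_mat_def inverts_mat_def)
qed

lemma pow_mat_vec_eq_orbit:
  assumes A: "A \<in> carrier_mat N N" and x: "\<And>k. x k \<in> carrier_vec N"
    and step: "\<And>k. x (Suc k) = A *\<^sub>v x k"
  shows "(A ^\<^sub>m k) *\<^sub>v x 0 = x k"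
  using x step
\<comment> \<open>The power k + 1 is A^k A, so the new factor acts on the initial vector; the
  induction hypothesis is used for the shifted orbit.\<close>
proof (induction k arbitrary: x)
  case 0
  then show ?case using A by simp
next
  case (Suc k)
  have "(A ^\<^sub>m Suc k) *\<^sub>v x 0 = (A ^\<^sub>m k) *\<^sub>v (A *\<^sub>v x 0)"
    using A Suc.prems(1)[of 0] assoc_mult_mat_vec[of "A ^\<^sub>m k" N N A N "x 0"] by simp
  also have "\<dots> = x (Suc k)"
    using Suc.IH[of "\<lambda>k. x (Suc k)", OF Suc.prems] by (simp only: Suc.prems(2))
  finally show ?case .
qed

section \<open>Companion matrices\<close>

abbreviation companion_mat :: "nat \<Rightarrow> real vec \<Rightarrow> real mat" where
  "companion_mat n a \<equiv> J_mat n - outer_prod (e_vec n) a"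

lemma companion_mat_carrier [simp]:
  "a \<in> carrier_vec n \<Longrightarrow> companion_mat n a \<in> carrier_mat n n"
  by (auto simp: J_mat_def outer_prod_def e_vec_def)

lemma companion_mat_index:
  assumes "a \<in> carrier_vec n" "i < n" "j < n"
  shows "companion_mat n a $$ (i, j) = (if i = j + 1 then 1 else 0) - (if i = 0 then a $ j else 0)"
  using assms by (auto simp: J_mat_def outer_prod_def e_vec_def)

lemma companion_mat_mult_vec:
  assumes a: "a \<in> carrier_vec n" and v: "v \<in> carrier_vec n" and i: "i < n"
  shows "(companion_mat n a *\<^sub>v v) $ i = (if i = 0 then - (\<Sum>j<n. a $ j * v $ j) else v $ (i - 1))"
proof -
  have "(companion_mat n a *\<^sub>v v) $ i = row (companion_mat n a) i \<bullet> v"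
    using a v i companion_mat_carrier[OF a] by (intro index_mult_mat_vec) auto
  also have "\<dots> = (\<Sum>j<n. companion_mat n a $$ (i, j) * v $ j)"
    using v i companion_mat_carrier[OF a] unfolding scalar_prod_def
    by (intro sum.cong) (auto simp: index_row(1)[of i "companion_mat n a"] atLeast0LessThan)
  also have "\<dots> = (\<Sum>j<n. ((if i = j + 1 then 1 else 0) - (if i = 0 then a $ j else 0)) * v $ j)"
    by (intro sum.cong refl) (subst companion_mat_index[OF a i], auto)
  also have "\<dots> = (if i = 0 then - (\<Sum>j<n. a $ j * v $ j) else v $ (i - 1))"
  proof (cases i)
    case 0
    then show ?thesis by (simp add: sum_negf)
  next
    case (Suc m)
    then show ?thesis using i by (simp add: if_distrib[of "\<lambda>x. x * _"] sum.delta cong: if_cong)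
  qed
  finally show ?thesis .
qed

lemma rec_poly_inverse: "fps_of_poly (rec_poly a) * inverse (fps_of_poly (rec_poly a)) = 1"
  by (rule inverse_mult_eq_1') simp

text \<open>The power series \<open>P / a\<close> with \<open>degree P < n\<close> are exactly the solutions of the recursion
  with characteristic polynomial \<open>hat_poly a\<close>; windows of length \<open>n\<close> of their coefficients are
  the orbits of the companion matrix.\<close>

definition window :: "nat \<Rightarrow> real fps \<Rightarrow> nat \<Rightarrow> real vec" where
  "window n f k = Matrix.vec n (\<lambda>i. fps_nth f (k + (n - 1 - i)))"

lemma window_carrier [simp]: "window n f k \<in> carrier_vec n"
  by (simp add: window_def)

text \<open>The top entry of a window is its newest coefficient. Comparing coefficients of order k +
  n in a f = P, where P has none, expresses the next one through the previous n: this is the first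
  row of the companion matrix, and the other rows shift.\<close>

lemma window_Suc:
  assumes a: "a \<in> carrier_vec n" and P: "\<And>m. m \<ge> n \<Longrightarrow> fps_nth P m = 0"
    and f: "f = P * inverse (fps_of_poly (rec_poly a))"
  shows "window n f (Suc k) = companion_mat n a *\<^sub>v window n f k"
proof (rule eq_vecI)
  fix i assume "i < dim_vec (companion_mat n a *\<^sub>v window n f k)"
  then have i: "i < n" using companion_mat_carrier[OF a] by (simp add: carrier_matD)
  have "fps_of_poly (rec_poly a) * f = P"
    using rec_poly_inverse[of a] by (simp add: f mult.left_commute)
  then have "0 = fps_nth (fps_of_poly (rec_poly a) * f) (k + n)"
    using P[of "k + n"] by simp
  also have "\<dots> = (\<Sum>j=0..k+n. coeff (rec_poly a) j * fps_nth f (k + n - j))"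
    by (simp add: fps_mult_nth)
  also have "\<dots> = (\<Sum>j=0..n. coeff (rec_poly a) j * fps_nth f (k + n - j))"
    using a by (intro sum.mono_neutral_right) (auto simp: coeff_rec_poly)
  also have "\<dots> = fps_nth f (k + n) + (\<Sum>j<n. a $ j * fps_nth f (k + (n - 1 - j)))"
    using a by (simp add: sum.atLeast0_atMost_Suc_shift sum.atLeast_Suc_atMost atLeast0AtMost[symmetric]
        sum.atLeast_Suc_atMost_Suc_shift coeff_rec_poly arma_coeff_def sum.atLeast1_atMost_eq lessThan_Suc_atMost del: sum.atLeast0_atMost_Suc)
  finally have rec: "fps_nth f (k + n) = - (\<Sum>j<n. a $ j * fps_nth f (k + (n - 1 - j)))" by simp
  show "window n f (Suc k) $ i = (companion_mat n a *\<^sub>v window n f k) $ i"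
  proof (cases "i = 0")
    case True
    then show ?thesis
      unfolding companion_mat_mult_vec[OF a window_carrier i] using i rec by (simp add: window_def)
  next
    case False
    then obtain m where "i = Suc m" by (cases i) auto
    then show ?thesis
      unfolding companion_mat_mult_vec[OF a window_carrier i] using i by (simp add: window_def Suc_diff_Suc)
  qed
qed (use companion_mat_carrier[OF a] in \<open>simp add: window_def carrier_matD\<close>)

text \<open>Coefficient k + n of P/a is a combination, with weights independent of k, of the
  coefficients k + 1 to k + n of 1/a, which tend to 0.\<close>

lemma filter_quotient_tendsto_0:
  assumes z: "zeros_in_open_unit_disc (hat_poly a)" and P: "\<And>m. m \<ge> n \<Longrightarrow> fps_nth P m = 0"
  shows "fps_nth (P * inverse (fps_of_poly (rec_poly a))) \<longlonglongrightarrow> 0"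
proof -
  let ?\<alpha> = "inverse (fps_of_poly (rec_poly a))"
  obtain C r where r: "0 < r" "r < 1" "0 \<le> C" and \<alpha>: "\<And>k. \<bar>fps_nth ?\<alpha> k\<bar> \<le> C * r ^ k"
    using inverse_rec_poly_geometric[OF z] by metis
  have "(\<lambda>k. C * r ^ k) \<longlonglongrightarrow> C * 0" using r by (intro tendsto_mult_left LIMSEQ_power_zero) simp
  then have "fps_nth ?\<alpha> \<longlonglongrightarrow> 0"
    by (intro Lim_null_comparison[of "fps_nth ?\<alpha>" "\<lambda>k. C * r ^ k"]) (use \<alpha> in simp_all)
  then have "(\<lambda>k. \<Sum>i<n. fps_nth P i * fps_nth ?\<alpha> (k + (n - i))) \<longlonglongrightarrow> (\<Sum>i<n. fps_nth P i * 0)"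
    by (intro tendsto_sum tendsto_mult_left LIMSEQ_ignore_initial_segment)
  moreover have "fps_nth (P * ?\<alpha>) (k + n) = (\<Sum>i<n. fps_nth P i * fps_nth ?\<alpha> (k + (n - i)))" for k
  proof -
    have "fps_nth (P * ?\<alpha>) (k + n) = (\<Sum>i\<in>{0..k + n}. fps_nth P i * fps_nth ?\<alpha> (k + n - i))"
      by (simp add: fps_mult_nth)
    also have "\<dots> = (\<Sum>i<n. fps_nth P i * fps_nth ?\<alpha> (k + n - i))"
      using P by (intro sum.mono_neutral_right) auto
    finally show ?thesis by simp
  qed
  ultimately have "(\<lambda>k. fps_nth (P * ?\<alpha>) (k + n)) \<longlonglongrightarrow> 0" by simp
  then show ?thesis by (rule LIMSEQ_offset)
qed

text \<open>Column j of the powers is the orbit of the j-th unit vector. Realised as the windows of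
  a quotient P/a, it inherits the decay of the coefficients of that quotient.\<close>

lemma companion_mat_pow_tendsto_0:
  assumes a: "a \<in> carrier_vec n" and z: "zeros_in_open_unit_disc (hat_poly a)" and ij: "i < n" "j < n"
  shows "(\<lambda>k. (companion_mat n a ^\<^sub>m k) $$ (i, j)) \<longlonglongrightarrow> 0"
proof -
  let ?A = "fps_of_poly (rec_poly a)"
  \<comment> \<open>Windows list coefficients in decreasing order, so the first window of this
    monomial is the j-th unit vector. Truncating V a at order n keeps the coefficients of the
    quotient below n and makes P vanish from n on, as \<open>window_Suc\<close> requires.\<close>
  define V :: "real fps" where "V = fps_X ^ (n - 1 - j)"
  define P where "P = fps_cutoff n (V * ?A)"
  define f where "f = P * inverse ?A"
  have P0: "fps_nth P m = 0" if "m \<ge> n" for m using that by (simp add: P_def)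
  have low: "fps_nth f m = fps_nth V m" if "m < n" for m
  proof -
    have "fps_nth f m = (\<Sum>i=0..m. fps_nth (V * ?A) i * fps_nth (inverse ?A) (m - i))"
      unfolding f_def fps_mult_nth[of P] using that by (intro sum.cong) (auto simp: P_def)
    also have "\<dots> = fps_nth (V * ?A * inverse ?A) m" by (simp only: fps_mult_nth[of "V * ?A"])
    also have "V * ?A * inverse ?A = V" using rec_poly_inverse[of a] by (simp add: mult.assoc)
    finally show ?thesis .
  qed
  have w0: "window n f 0 = unit_vec n j"
    using ij by (intro eq_vecI) (auto simp: window_def low V_def unit_vec_def fps_X_power_nth)
  have pow: "companion_mat n a ^\<^sub>m k \<in> carrier_mat n n" for k
    using companion_mat_carrier[OF a] by (rule pow_carrier_mat)
  have "(companion_mat n a ^\<^sub>m k) $$ (i, j) = fps_nth f (k + (n - 1 - i))" for k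
  proof -
    have "companion_mat n a ^\<^sub>m k *\<^sub>v unit_vec n j = window n f k"
      unfolding w0[symmetric]
      by (rule pow_mat_vec_eq_orbit[OF companion_mat_carrier[OF a]])
        (simp, rule window_Suc[OF a P0 f_def])
    then have "(companion_mat n a ^\<^sub>m k *\<^sub>v unit_vec n j) $ i = fps_nth f (k + (n - 1 - i))"
      using ij by (simp add: window_def)
    moreover have "(Q *\<^sub>v unit_vec n j) $ i = Q $$ (i, j)" if "Q \<in> carrier_mat n n" for Q :: "real mat"
      using that ij by simp
    ultimately show ?thesis using pow[of k] by metis
  qed
  moreover have "(\<lambda>k. fps_nth f (k + (n - 1 - i))) \<longlonglongrightarrow> 0"
    using filter_quotient_tendsto_0[OF z P0] unfolding f_def by (rule LIMSEQ_ignore_initial_segment)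
  ultimately show ?thesis by simp
qed

lemma F_mat_carrier [simp]:
  assumes "a \<in> carrier_vec n" "c \<in> carrier_vec n"
  shows "F_mat n a c \<in> carrier_mat (2 * n) (2 * n)"
  using four_block_carrier_mat[OF companion_mat_carrier[OF assms(1)] companion_mat_carrier[OF assms(2)]]
  by (simp add: F_mat_def mult_2)

lemma F_mat_pow_tendsto_0:
  assumes a: "a \<in> carrier_vec n" "zeros_in_open_unit_disc (hat_poly a)"
    and c: "c \<in> carrier_vec n" "zeros_in_open_unit_disc (hat_poly c)" and ij: "i < 2 * n" "j < 2 * n"
  shows "(\<lambda>k. (F_mat n a c ^\<^sub>m k) $$ (i, j)) \<longlonglongrightarrow> 0"
proof -
  have pow: "companion_mat n a ^\<^sub>m k \<in> carrier_mat n n" "companion_mat n c ^\<^sub>m k \<in> carrier_mat n n" for k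
    using a c companion_mat_carrier by (auto intro!: pow_carrier_mat)
  have "(F_mat n a c ^\<^sub>m k) $$ (i, j) =
      (if i < n then if j < n then (companion_mat n a ^\<^sub>m k) $$ (i, j) else 0
       else if j < n then 0 else (companion_mat n c ^\<^sub>m k) $$ (i - n, j - n))" for k
    unfolding F_mat_def
      pow_four_block_mat[OF companion_mat_carrier[OF a(1)] companion_mat_carrier[OF c(1)]]
    using ij carrier_matD[OF pow(1)[of k]] carrier_matD[OF pow(2)[of k]] by (subst index_mat_four_block) auto
  then show ?thesis
    using companion_mat_pow_tendsto_0[OF a, of i j] companion_mat_pow_tendsto_0[OF c, of "i - n" "j - n"] ij
    by (cases "i < n"; cases "j < n") simp_all
qed

section \<open>Coefficient vectors of the score\<close>

lemma B_vec_carrier [simp]: "B_vec n \<in> carrier_vec (2 * n)"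
  by (simp add: B_vec_def e_vec_def mult_2)

text \<open>Within each block, position i (from 0) lags the noise by i + 1. One of these lags is
  left to the time origin t - 1, so that the coefficient vector at k = 0 is B.\<close>

definition score_filter :: "nat \<Rightarrow> real vec \<Rightarrow> real vec \<Rightarrow> nat \<Rightarrow> real fps" where
  "score_filter n a c i =
     (if i < n then fps_X ^ i * inverse (fps_of_poly (rec_poly a))
      else - (fps_X ^ (i - n) * inverse (fps_of_poly (rec_poly c))))"

definition score_vec :: "nat \<Rightarrow> real vec \<Rightarrow> real vec \<Rightarrow> nat \<Rightarrow> real vec" where
  "score_vec n a c k = Matrix.vec (2 * n) (\<lambda>i. fps_nth (score_filter n a c i) k)"

lemma score_vec_carrier [simp]: "score_vec n a c k \<in> carrier_vec (2 * n)"
  by (simp add: score_vec_def)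

text \<open>Delaying 1/a by i and reading at k is the same as delaying it by n - 1 and reading at k
  + n - 1 - i. So the n delays of one series fill a single window.\<close>

lemma score_vec_eq_windows:
  "score_vec n a c k =
     window n (fps_X ^ (n - 1) * inverse (fps_of_poly (rec_poly a))) k @\<^sub>v
     - window n (fps_X ^ (n - 1) * inverse (fps_of_poly (rec_poly c))) k"
  by (rule eq_vecI) (auto simp: score_vec_def score_filter_def window_def fps_X_power_mult_nth mult_2)

lemma score_vec_0:
  assumes "n \<ge> 1"
  shows "score_vec n a c 0 = B_vec n"
  using assms by (intro eq_vecI)
    (auto simp: score_vec_def score_filter_def B_vec_def e_vec_def fps_X_power_mult_nth unit_vec_def)

lemma score_vec_Suc:
  assumes n: "n \<ge> 1" and a: "a \<in> carrier_vec n" and c: "c \<in> carrier_vec n"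
  shows "score_vec n a c (Suc k) = F_mat n a c *\<^sub>v score_vec n a c k"
proof -
  have X: "fps_nth (fps_X ^ (n - 1) :: real fps) m = 0" if "m \<ge> n" for m
    using that n by (auto simp: fps_X_power_nth)
  let ?fa = "fps_X ^ (n - 1) * inverse (fps_of_poly (rec_poly a))"
  let ?fc = "fps_X ^ (n - 1) * inverse (fps_of_poly (rec_poly c))"
  have wa: "window n ?fa (Suc k) = companion_mat n a *\<^sub>v window n ?fa k"
    by (rule window_Suc[OF a _ refl], rule X)
  have wc: "window n ?fc (Suc k) = companion_mat n c *\<^sub>v window n ?fc k"
    by (rule window_Suc[OF c _ refl], rule X)
  have split: "F_mat n a c *\<^sub>v (v @\<^sub>v w) = (companion_mat n a *\<^sub>v v) @\<^sub>v (companion_mat n c *\<^sub>v w)"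
    if "v \<in> carrier_vec n" "w \<in> carrier_vec n" for v w
    unfolding F_mat_def using that companion_mat_carrier[OF a] companion_mat_carrier[OF c]
    by (intro mult_mat_vec_split) auto
  show ?thesis
    unfolding score_vec_eq_windows wa wc by (subst split) (simp_all only: mult_mat_vec_uminus[OF companion_mat_carrier[OF c]] window_carrier uminus_carrier_vec)
qed

section \<open>The change of basis\<close>

lemma P_mat_carrier [simp]: "P_mat n \<in> carrier_mat n n"
  by (simp add: P_mat_def)

lemma S_mat_carrier [simp]: "S_mat n a \<in> carrier_mat n n"
  by (simp add: S_mat_def)

lemma P_mat_mult_left:
  assumes "X \<in> carrier_mat n m" "i < n" "j < m"
  shows "(P_mat n * X) $$ (i, j) = X $$ (n - 1 - i, j)"
proof -
  have "(P_mat n * X) $$ (i, j) = (\<Sum>l<n. P_mat n $$ (i, l) * X $$ (l, j))"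
    using assms carrier_matD[OF P_mat_carrier[of n]] by (simp add: scalar_prod_def atLeast0LessThan)
  also have "\<dots> = (\<Sum>l<n. if l = n - 1 - i then X $$ (l, j) else 0)"
    using assms by (intro sum.cong) (auto simp: P_mat_def)
  also have "\<dots> = X $$ (n - 1 - i, j)" using assms by (simp add: sum.delta)
  finally show ?thesis .
qed

lemma P_mat_mult_right:
  assumes "X \<in> carrier_mat m n" "i < m" "j < n"
  shows "(X * P_mat n) $$ (i, j) = X $$ (i, n - 1 - j)"
proof -
  have "(X * P_mat n) $$ (i, j) = (\<Sum>l<n. X $$ (i, l) * P_mat n $$ (l, j))"
    using assms carrier_matD[OF P_mat_carrier[of n]] by (simp add: scalar_prod_def atLeast0LessThan)
  also have "\<dots> = (\<Sum>l<n. if l = n - 1 - j then X $$ (i, l) else 0)"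
    using assms by (intro sum.cong) (auto simp: P_mat_def)
  also have "\<dots> = X $$ (i, n - 1 - j)" using assms by (simp add: sum.delta)
  finally show ?thesis .
qed

lemma P_mat_square: "P_mat n * P_mat n = 1\<^sub>m n"
proof (rule eq_matI)
  fix i j assume "i < dim_row (1\<^sub>m n)" "j < dim_col (1\<^sub>m n)"
  then show "(P_mat n * P_mat n) $$ (i, j) = 1\<^sub>m n $$ (i, j)"
    using P_mat_mult_left[OF P_mat_carrier[of n], of i j] by (auto simp: P_mat_def)
qed (simp_all add: P_mat_def)

text \<open>Its entries depend on i + j only: zero above the main antidiagonal, 1 on it, and a_1,
  a_2, ... on the successive antidiagonals below.\<close>

abbreviation hankel_mat :: "nat \<Rightarrow> real vec \<Rightarrow> real mat" where
  "hankel_mat n a \<equiv> P_mat n * S_mat n a * P_mat n"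

lemma hankel_mat_carrier: "hankel_mat n a \<in> carrier_mat n n"
  by (intro mult_carrier_mat[of _ n n _ n] P_mat_carrier S_mat_carrier)

lemma hankel_mat_index:
  assumes "i < n" "j < n"
  shows "hankel_mat n a $$ (i, j) = (if n \<le> i + j + 1 then arma_coeff a (i + j + 1 - n) else 0)"
proof -
  have "hankel_mat n a $$ (i, j) = (P_mat n * S_mat n a) $$ (i, n - 1 - j)"
    using assms by (intro P_mat_mult_right mult_carrier_mat[of _ _ n]) auto
  also have "\<dots> = S_mat n a $$ (n - 1 - i, n - 1 - j)"
    using assms by (intro P_mat_mult_left[of _ n n]) auto
  also have "\<dots> = (if n \<le> i + j + 1 then arma_coeff a (i + j + 1 - n) else 0)"
  proof (cases "n \<le> i + j + 1")
    case True
    then have "n - 1 - (n - 1 - i) - (n - 1 - j) = i + j + 1 - n" using assms by auto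
    then show ?thesis using assms True by (auto simp: S_mat_def)
  next
    case False
    then show ?thesis using assms by (auto simp: S_mat_def)
  qed
  finally show ?thesis .
qed

lemma det_P_mat: "Determinant.det (P_mat n) \<noteq> 0"
  using det_mult[OF P_mat_carrier[of n] P_mat_carrier[of n]] by (auto simp: P_mat_square)

text \<open>Reversing only the rows of S gives a unit lower triangular matrix, of determinant 1; the
  remaining factor P is an involution.\<close>

lemma det_hankel_mat: "Determinant.det (hankel_mat n a) \<noteq> 0"
proof -
  have "Determinant.det (P_mat n * S_mat n a) = prod_list (diag_mat (P_mat n * S_mat n a))"
  proof (rule det_lower_triangular)
    fix i j assume "i < j" "j < n"
    then show "(P_mat n * S_mat n a) $$ (i, j) = 0"
      by (subst P_mat_mult_left[of _ n n]) (auto simp: S_mat_def)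
  qed (intro mult_carrier_mat[of _ n n _ n] P_mat_carrier S_mat_carrier)
  also have "diag_mat (P_mat n * S_mat n a) = map (\<lambda>i. 1) [0..<n]"
    unfolding diag_mat_def
    by (intro map_cong) (auto simp: P_mat_mult_left[of _ n n] S_mat_def arma_coeff_def simp del: index_mult_mat(1),
        simp add: P_mat_def)
  also have "prod_list \<dots> = 1" by (induction n) auto
  finally have "Determinant.det (P_mat n * S_mat n a) = 1" .
  then show ?thesis
    using det_mult[of "P_mat n * S_mat n a" n "P_mat n"] det_P_mat by simp
qed

lemma M_mat_carrier: "M_mat n c a \<in> carrier_mat (2 * n) (2 * n)"
  unfolding M_mat_def mult_2 by (intro four_block_carrier_mat P_mat_carrier hankel_mat_carrier)

lemma
  shows M_inv_carrier: "M_inv n c a \<in> carrier_mat (2 * n) (2 * n)"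
    and M_mat_M_inv: "M_mat n c a * M_inv n c a = 1\<^sub>m (2 * n)"
    and M_inv_M_mat: "M_inv n c a * M_mat n c a = 1\<^sub>m (2 * n)"
proof -
  \<comment> \<open>Block triangularity makes the determinant a product of nonzero factors, so
    \<open>mat_inverse\<close> succeeds and the \<open>the\<close> in \<open>M_inv\<close> yields an
    actual inverse.\<close>
  have "Determinant.det (M_mat n c a) = Determinant.det (P_mat n) * Determinant.det (hankel_mat n c)"
    unfolding M_mat_def by (rule det_four_block_mat_upper_right_zero[of _ n _ n]) (simp_all add: hankel_mat_carrier)
  then have "Determinant.det (M_mat n c a) \<noteq> 0" using det_P_mat det_hankel_mat by simp
  then have "M_mat n c a \<in> Units (ring_mat TYPE(real) (2 * n) ())"
    by (rule det_non_zero_imp_unit[OF M_mat_carrier])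
  then obtain L where "mat_inverse (M_mat n c a) = Some L"
    using mat_inverse(1)[OF M_mat_carrier[of n c a], where b = "()"]
    by (cases "mat_inverse (M_mat n c a)") auto
  then show "M_inv n c a \<in> carrier_mat (2 * n) (2 * n)"
    "M_mat n c a * M_inv n c a = 1\<^sub>m (2 * n)" "M_inv n c a * M_mat n c a = 1\<^sub>m (2 * n)"
    using mat_inverse(2)[OF M_mat_carrier] by (auto simp: M_inv_def)
qed

section \<open>Intertwining of companion matrices\<close>

lemma mult_companion_mat_index:
  assumes a: "a \<in> carrier_vec n" and X: "X \<in> carrier_mat m n" and ij: "i < m" "j < n"
  shows "(X * companion_mat n a) $$ (i, j) = (if j + 1 < n then X $$ (i, j + 1) else 0) - X $$ (i, 0) * a $ j"
proof -
  have "(X * companion_mat n a) $$ (i, j) = row X i \<bullet> col (companion_mat n a) j"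
    using X ij companion_mat_carrier[OF a] by (intro index_mult_mat) auto
  also have "\<dots> = (\<Sum>l<n. X $$ (i, l) * companion_mat n a $$ (l, j))"
    using X ij a unfolding scalar_prod_def
    by (intro sum.cong) (auto simp: atLeast0LessThan simp del: index_minus_mat(1))
  also have "\<dots> = (\<Sum>l<n. (if l = j + 1 then X $$ (i, l) else 0) - (if l = 0 then X $$ (i, l) * a $ j else 0))"
    using ij by (intro sum.cong refl) (subst companion_mat_index[OF a], auto)
  also have "\<dots> = (if j + 1 < n then X $$ (i, j + 1) else 0) - X $$ (i, 0) * a $ j"
    using ij by (simp add: sum_subtractf sum.delta)
  finally show ?thesis .
qed

text \<open>Conjugation by P turns the lower shift J into the upper shift, so rows move up, while
  the rank one term feeds back row 0.\<close>

lemma reversed_companion_mult_index: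
  assumes c: "c \<in> carrier_vec n" and X: "X \<in> carrier_mat n m" and ij: "i < n" "j < m"
  shows "((P_mat n * J_mat n * P_mat n - outer_prod c (e_vec n)) * X) $$ (i, j)
    = (if i + 1 < n then X $$ (i + 1, j) else 0) - c $ i * X $$ (0, j)"
proof -
  let ?R = "P_mat n * J_mat n * P_mat n - outer_prod c (e_vec n)"
  have J: "J_mat n \<in> carrier_mat n n" by (simp add: J_mat_def)
  have PJP: "P_mat n * J_mat n * P_mat n \<in> carrier_mat n n"
    using J by (intro mult_carrier_mat[of _ n n _ n] P_mat_carrier)
  have R: "?R \<in> carrier_mat n n" using c by (intro minus_carrier_mat) (auto simp: e_vec_def)
  have entry: "?R $$ (i, l) = (if l = i + 1 then 1 else 0) - (if l = 0 then c $ i else 0)" if l: "l < n" for l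
  proof -
    have "(P_mat n * J_mat n * P_mat n) $$ (i, l) = (P_mat n * J_mat n) $$ (i, n - 1 - l)"
      using ij l J by (intro P_mat_mult_right mult_carrier_mat[of _ _ n]) auto
    also have "\<dots> = J_mat n $$ (n - 1 - i, n - 1 - l)"
      using ij l J by (intro P_mat_mult_left[of _ n n]) auto
    also have "\<dots> = (if l = i + 1 then 1 else 0)"
      using ij l by (auto simp: J_mat_def)
    finally have "(P_mat n * J_mat n * P_mat n) $$ (i, l) = (if l = i + 1 then 1 else 0)" .
    moreover have "?R $$ (i, l) = (P_mat n * J_mat n * P_mat n) $$ (i, l) - outer_prod c (e_vec n) $$ (i, l)"
      using ij l c by (intro index_minus_mat) auto
    moreover have "outer_prod c (e_vec n) $$ (i, l) = (if l = 0 then c $ i else 0)"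
      using ij l c by (auto simp: outer_prod_def e_vec_def)
    ultimately show ?thesis by simp
  qed
  have "(?R * X) $$ (i, j) = row ?R i \<bullet> col X j"
    using X ij R by (intro index_mult_mat) auto
  also have "\<dots> = (\<Sum>l<n. ?R $$ (i, l) * X $$ (l, j))"
    using X ij c R unfolding scalar_prod_def
    by (intro sum.cong) (auto simp: atLeast0LessThan simp del: index_minus_mat(1))
  also have "\<dots> = (\<Sum>l<n. (if l = i + 1 then X $$ (l, j) else 0) - (if l = 0 then c $ i * X $$ (l, j) else 0))"
    by (intro sum.cong refl) (subst entry, auto)
  also have "\<dots> = (if i + 1 < n then X $$ (i + 1, j) else 0) - c $ i * X $$ (0, j)"
    using ij by (simp add: sum_subtractf sum.delta)
  finally show ?thesis .
qed

text \<open>The left side moves columns left, the right side moves rows up, and these agree on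
  entries depending on i + j. Apart from the corner, the left side cancels to 0 in the last row and
  the right side in the last column; at the corner both are -a_n.\<close>

lemma hankel_mat_companion_index:
  assumes a: "a \<in> carrier_vec n" and ij: "i < n" "j < n"
  shows "(hankel_mat n a * companion_mat n a) $$ (i, j)
    = (if i + 1 < n then hankel_mat n a $$ (i + 1, j) else 0) - a $ i * hankel_mat n a $$ (0, j)"
proof -
  consider "Suc i < n" "Suc j < n" | "n = Suc i" "Suc j < n" | "Suc i < n" "n = Suc j" | "n = Suc i" "n = Suc j"
    using ij by linarith
  then show ?thesis
    unfolding mult_companion_mat_index[OF a hankel_mat_carrier ij]
    by cases (auto simp: hankel_mat_index arma_coeff_def)
qed

lemma M_mat_F_mat:
  assumes a: "a \<in> carrier_vec n" and c: "c \<in> carrier_vec n"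
  shows "M_mat n c a * F_mat n a c = G_mat n a c * M_mat n c a"
proof -
  let ?R = "P_mat n * J_mat n * P_mat n - outer_prod c (e_vec n)"
  let ?Ca = "companion_mat n a" and ?Cc = "companion_mat n c"
  let ?Ta = "hankel_mat n a" and ?Tc = "hankel_mat n c"
  have Ca: "?Ca \<in> carrier_mat n n" and Cc: "?Cc \<in> carrier_mat n n" using a c by auto
  have R: "?R \<in> carrier_mat n n" using c by (intro minus_carrier_mat) (auto simp: e_vec_def)
  have E: "outer_prod (c - a) (e_vec n) \<in> carrier_mat n n" using a c by (auto simp: e_vec_def)
  note car = P_mat_carrier[of n] hankel_mat_carrier[of n a] hankel_mat_carrier[of n c]
  have cc: "?Tc * ?Cc = ?R * ?Tc"
  proof (rule eq_matI)
    fix i j assume "i < dim_row (?R * ?Tc)" "j < dim_col (?R * ?Tc)"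
    then have "i < n" "j < n" using c by (auto simp: P_mat_def)
    then show "(?Tc * ?Cc) $$ (i, j) = (?R * ?Tc) $$ (i, j)"
      by (simp only: hankel_mat_companion_index[OF c] reversed_companion_mult_index[OF c car(3)])
  qed (use c a in \<open>auto simp: P_mat_def\<close>)
  \<comment> \<open>The Hankel matrix of a carries the companion matrix of a to PJP - a e^T, whereas
    \<open>?R\<close> is built from c. The difference (c - a) e^T meets only the first row of the
    Hankel matrix, which is the last unit row and so equals e^T P.\<close>
  have ca: "?Ta * ?Ca = outer_prod (c - a) (e_vec n) * P_mat n + ?R * ?Ta"
  proof (rule eq_matI)
    fix i j assume "i < dim_row (outer_prod (c - a) (e_vec n) * P_mat n + ?R * ?Ta)"
      "j < dim_col (outer_prod (c - a) (e_vec n) * P_mat n + ?R * ?Ta)"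
    then have ij: "i < n" "j < n" using c by (auto simp: P_mat_def)
    have "(outer_prod (c - a) (e_vec n) * P_mat n) $$ (i, j) = outer_prod (c - a) (e_vec n) $$ (i, n - 1 - j)"
      using ij E by (intro P_mat_mult_right) auto
    also have "\<dots> = (c $ i - a $ i) * hankel_mat n a $$ (0, j)"
      using ij a c by (auto simp: outer_prod_def e_vec_def hankel_mat_index arma_coeff_def)
    finally have 1: "(outer_prod (c - a) (e_vec n) * P_mat n) $$ (i, j) = (c $ i - a $ i) * hankel_mat n a $$ (0, j)" .
    have "(outer_prod (c - a) (e_vec n) * P_mat n + ?R * ?Ta) $$ (i, j)
        = (outer_prod (c - a) (e_vec n) * P_mat n) $$ (i, j) + (?R * ?Ta) $$ (i, j)"
      using ij c by (intro index_add_mat) (auto simp: P_mat_def)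
    then show "(?Ta * ?Ca) $$ (i, j) = (outer_prod (c - a) (e_vec n) * P_mat n + ?R * ?Ta) $$ (i, j)"
      unfolding 1 hankel_mat_companion_index[OF a ij] reversed_companion_mult_index[OF c car(2) ij]
      by (simp add: algebra_simps)
  qed (use c a in \<open>auto simp: P_mat_def\<close>)
  have blocks: "four_block_mat P (0\<^sub>m n n) S T * four_block_mat C (0\<^sub>m n n) (0\<^sub>m n n) D
        = four_block_mat (P * C) (0\<^sub>m n n) (S * C) (T * D)"
      "four_block_mat C (0\<^sub>m n n) D Q * four_block_mat P (0\<^sub>m n n) S T
        = four_block_mat (C * P) (0\<^sub>m n n) (D * P + Q * S) (Q * T)"
    if "P \<in> carrier_mat n n" "S \<in> carrier_mat n n" "T \<in> carrier_mat n n"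
      "C \<in> carrier_mat n n" "D \<in> carrier_mat n n" "Q \<in> carrier_mat n n" for P S T C D Q :: "real mat"
    using that by (simp_all add: mult_four_block_mat[of _ n n _ n _ n _ _ n _ n])
  have PCP: "P_mat n * ?Ca * P_mat n \<in> carrier_mat n n"
    by (intro mult_carrier_mat[of _ n n _ n] car Ca)
  have "M_mat n c a * F_mat n a c = four_block_mat (P_mat n * ?Ca) (0\<^sub>m n n) (?Ta * ?Ca) (?Tc * ?Cc)"
    unfolding M_mat_def F_mat_def by (rule blocks(1)[OF car Ca Cc R])
  \<comment> \<open>Inserting P P = 1 produces the conjugated block that occurs in
    \<open>G_mat\<close>.\<close>
  also have "P_mat n * ?Ca = (P_mat n * ?Ca * P_mat n) * P_mat n"
    using Ca car(1) by (simp add: assoc_mult_mat[of _ n n _ n _ n] P_mat_square right_mult_one_mat[OF Ca])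
  also have "four_block_mat ((P_mat n * ?Ca * P_mat n) * P_mat n) (0\<^sub>m n n) (?Ta * ?Ca) (?Tc * ?Cc)
      = G_mat n a c * M_mat n c a"
    unfolding M_mat_def G_mat_def
    unfolding cc ca by (rule blocks(2)[OF car PCP E R, symmetric])
  finally show ?thesis .
qed

text \<open>Both Hankel blocks have the last unit vector as first column, so the halves e and -e of
  B cancel in the lower block.\<close>

lemma M_mat_B_vec:
  assumes "n \<ge> 1"
  shows "M_mat n c a *\<^sub>v B_vec n = eP_vec n"
proof -
  have e: "e_vec n \<in> carrier_vec n" by (simp add: e_vec_def)
  have T: "hankel_mat n b *\<^sub>v e_vec n = unit_vec n (n - 1)" for b
  proof (rule eq_vecI)
    fix i assume "i < dim_vec (unit_vec n (n - 1))"
    then have i: "i < n" by simp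
    have "(Q *\<^sub>v unit_vec n 0) $ i = Q $$ (i, 0)" if "Q \<in> carrier_mat n n" for Q :: "real mat"
      using that i assms by simp
    then have "(hankel_mat n b *\<^sub>v e_vec n) $ i = hankel_mat n b $$ (i, 0)"
      unfolding e_vec_def using hankel_mat_carrier[of n b] by metis
    then show "(hankel_mat n b *\<^sub>v e_vec n) $ i = unit_vec n (n - 1) $ i"
      using i assms by (auto simp: hankel_mat_index arma_coeff_def)
  qed (simp add: P_mat_def)
  have Tm: "hankel_mat n b *\<^sub>v (- e_vec n) = - unit_vec n (n - 1)" for b
    unfolding mult_mat_vec_uminus[OF hankel_mat_carrier e] T ..
  have e': "- e_vec n \<in> carrier_vec n" using e by simp
  have Z: "P_mat n *\<^sub>v e_vec n + 0\<^sub>m n n *\<^sub>v (- e_vec n) = P_mat n *\<^sub>v e_vec n"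
    "unit_vec n (n - 1) + - unit_vec n (n - 1) = (0\<^sub>v n :: real vec)"
    by (auto intro!: eq_vecI simp: scalar_prod_def P_mat_def)
  show ?thesis
    unfolding M_mat_def B_vec_def eP_vec_def
      four_block_mat_mult_vec[OF P_mat_carrier zero_carrier_mat hankel_mat_carrier hankel_mat_carrier e e']
      T Tm Z ..
qed

lemma G_mat_carrier:
  assumes a: "a \<in> carrier_vec n" and c: "c \<in> carrier_vec n"
  shows "G_mat n a c \<in> carrier_mat (2 * n) (2 * n)"
  unfolding G_mat_def mult_2
  by (intro four_block_carrier_mat minus_carrier_mat mult_carrier_mat[of _ n n] P_mat_carrier companion_mat_carrier a)
    (use c in \<open>auto simp: e_vec_def\<close>)

section \<open>The Fisher information matrix\<close>

text \<open>A single C and r for all 2n filters let them share one dominating variable. The larger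
  rate and constant are taken, and a delay below n costs at most a factor r^(-n).\<close>

lemma score_filter_geometric:
  assumes "zeros_in_open_unit_disc (hat_poly a)" "zeros_in_open_unit_disc (hat_poly c)"
  obtains C r where "0 < r" "r < 1"
    "\<And>i k. i < 2 * n \<Longrightarrow> \<bar>fps_nth (score_filter n a c i) k\<bar> \<le> C * r ^ k"
proof -
  obtain C1 r1 where 1: "0 < r1" "r1 < 1" "0 \<le> C1"
    "\<And>k. \<bar>fps_nth (inverse (fps_of_poly (rec_poly a))) k\<bar> \<le> C1 * r1 ^ k"
    using inverse_rec_poly_geometric[OF assms(1)] by metis
  obtain C2 r2 where 2: "0 < r2" "r2 < 1" "0 \<le> C2"
    "\<And>k. \<bar>fps_nth (inverse (fps_of_poly (rec_poly c))) k\<bar> \<le> C2 * r2 ^ k"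
    using inverse_rec_poly_geometric[OF assms(2)] by metis
  define r where "r = max r1 r2"
  define C where "C = max C1 C2"
  have r: "0 < r" "r < 1" and C: "0 \<le> C" using 1 2 by (auto simp: r_def C_def)
  have shift: "\<bar>fps_nth (fps_X ^ m * f) k\<bar> \<le> C / r ^ n * r ^ k"
    if f: "\<And>k. \<bar>fps_nth f k\<bar> \<le> D * s ^ k" and s: "0 < s" "s \<le> r" and D: "0 \<le> D" "D \<le> C" and m: "m < n"
    for f :: "real fps" and D s m k
  proof (cases "k < m")
    case True
    then show ?thesis using r C by (simp add: fps_X_power_mult_nth)
  next
    case False
    have "\<bar>fps_nth f (k - m)\<bar> \<le> D * s ^ (k - m)" by (rule f)
    also have "\<dots> \<le> C * r ^ (k - m)"
      using s D C by (intro mult_mono power_mono) auto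
    also have "\<dots> = C / r ^ m * r ^ k" using r False by (simp add: power_diff)
    also have "\<dots> \<le> C / r ^ n * r ^ k"
      using r C m by (intro mult_right_mono divide_left_mono power_decreasing) auto
    finally show ?thesis using False by (simp add: fps_X_power_mult_nth)
  qed
  show ?thesis
  proof (rule that[OF r])
    fix i k assume "i < 2 * n"
    then show "\<bar>fps_nth (score_filter n a c i) k\<bar> \<le> C / r ^ n * r ^ k"
      using shift[OF 1(4), of i k] shift[OF 2(4), of "i - n" k] 1 2
      by (auto simp: score_filter_def r_def C_def)
  qed
qed

text \<open>The first m terms of the delayed series vanish; splitting them off a
  \<open>suminf\<close> relies on convergence.\<close>

lemma suminf_fps_X_power_shift:
  fixes x :: "int \<Rightarrow> real"
  assumes "summable (\<lambda>k. fps_nth (fps_X ^ m * f) k * x (s - int k))"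
  shows "(\<Sum>k. fps_nth f k * x (s - int m - int k)) = (\<Sum>k. fps_nth (fps_X ^ m * f) k * x (s - int k))"
proof -
  have "(\<Sum>k. fps_nth (fps_X ^ m * f) k * x (s - int k))
      = (\<Sum>k. fps_nth (fps_X ^ m * f) (k + m) * x (s - int (k + m)))
        + (\<Sum>k<m. fps_nth (fps_X ^ m * f) k * x (s - int k))"
    by (rule suminf_split_initial_segment[OF assms])
  also have "\<dots> = (\<Sum>k. fps_nth f k * x (s - int m - int k))"
  proof -
    have "(\<Sum>k<m. fps_nth (fps_X ^ m * f) k * x (s - int k)) = 0"
      by (intro sum.neutral) (simp add: fps_X_power_mult_nth)
    moreover have "s - int (k + m) = s - int m - int k" for k by simp
    ultimately show ?thesis by (simp only: fps_X_power_mult_nth) simp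
  qed
  finally show ?thesis by simp
qed

section \<open>The score process as filtered noise\<close>

lemma eps_dot_index:
  assumes "i < 2 * n"
  shows "eps_dot n a c \<epsilon> t \<omega> $ i = (if i < n then deriv_a a \<epsilon> (i + 1) t \<omega> else deriv_c c \<epsilon> (i - n + 1) t \<omega>)"
  using assms by (auto simp: eps_dot_def)

text \<open>\<open>eps_dot\<close> delays the time argument of the noise,
  \<open>score_filter\<close> the series. The two agree at every sample point where the series
  converges.\<close>

lemma eps_dot_eq_score_filter:
  assumes i: "i < 2 * n"
    and sm: "summable (\<lambda>k. fps_nth (score_filter n a c i) k * \<epsilon> (t - 1 - int k) \<omega>)"
  shows "eps_dot n a c \<epsilon> t \<omega> $ i = (\<Sum>k. fps_nth (score_filter n a c i) k * \<epsilon> (t - 1 - int k) \<omega>)"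
proof (cases "i < n")
  case True
  then show ?thesis
    using suminf_fps_X_power_shift[of i _ "\<lambda>s. \<epsilon> s \<omega>" "t - 1"] sm
    by (simp add: eps_dot_index[OF i] deriv_a_def lag_filter_def score_filter_def algebra_simps)
next
  case False
  let ?f = "inverse (fps_of_poly (rec_poly c))"
  have sm': "summable (\<lambda>k. fps_nth (fps_X ^ (i - n) * ?f) k * \<epsilon> (t - 1 - int k) \<omega>)"
    using summable_minus[OF sm] False by (simp add: score_filter_def)
  show ?thesis
    using suminf_fps_X_power_shift[of "i - n" _ "\<lambda>s. \<epsilon> s \<omega>" "t - 1", OF sm'] suminf_minus[OF sm'] False
    by (simp add: eps_dot_index[OF i] deriv_c_def lag_filter_def score_filter_def algebra_simps)
qed

text \<open>The noise covariance contributes a factor \<sigma>2 that cancels the prefactor, so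
  neither the variance nor t survives on the right.\<close>

lemma fisher_information_eq_gram_mat:
  assumes z: "zeros_in_open_unit_disc (hat_poly a)" "zeros_in_open_unit_disc (hat_poly c)"
    and pos: "\<sigma>2 > 0" and wn: "gaussian_white_noise M \<sigma>2 \<epsilon>"
  shows "fisher_information M \<sigma>2 n a c \<epsilon> t = gram_mat (2 * n) (score_vec n a c)"
proof -
  obtain C r where r: "0 < r" "r < 1"
    and bound: "\<And>i k. i < 2 * n \<Longrightarrow> \<bar>fps_nth (score_filter n a c i) k\<bar> \<le> C * r ^ k"
    using score_filter_geometric[OF z] by metis
  define x where "x = (\<lambda>k. \<epsilon> (t - 1 - int k))"
  have meas [measurable]: "\<epsilon> s \<in> borel_measurable M" for s
    using white_noise_integrable_square(3)[OF wn pos] by blast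
  have sq: "integrable M (\<lambda>\<omega>. (x k \<omega>)\<^sup>2)" "(\<integral>\<omega>. (x k \<omega>)\<^sup>2 \<partial>M) = \<sigma>2" for k
    unfolding x_def by (rule white_noise_integrable_square[OF wn pos])+
  have AE: "AE \<omega> in M. summable (\<lambda>k. r ^ k * (x k \<omega>)\<^sup>2)"
    by (rule geometric_weighted_square_summable(1)[OF r sq])
  \<comment> \<open>Where the series diverges the two sides may differ, so the identity is only
    almost sure; this suffices under the integral.\<close>
  have eq: "AE \<omega> in M. eps_dot n a c \<epsilon> t \<omega> $ i = (\<Sum>k. fps_nth (score_filter n a c i) k * x k \<omega>)"
    if "i < 2 * n" for i
    using AE
  proof eventually_elim
    fix \<omega> assume "summable (\<lambda>k. r ^ k * (x k \<omega>)\<^sup>2)"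
    then have "summable (\<lambda>k. fps_nth (score_filter n a c i) k * x k \<omega>)"
      by (rule geometric_weighted_summable[OF r bound[OF that]])
    then show "eps_dot n a c \<epsilon> t \<omega> $ i = (\<Sum>k. fps_nth (score_filter n a c i) k * x k \<omega>)"
      unfolding x_def by (rule eps_dot_eq_score_filter[OF that])
  qed
  have meas_eps: "(\<lambda>\<omega>. eps_dot n a c \<epsilon> t \<omega> $ i) \<in> borel_measurable M" if "i < 2 * n" for i
    unfolding eps_dot_index[OF that] deriv_a_def deriv_c_def lag_filter_def
    by (cases "i < n") (simp_all, measurable)
  have "(\<integral>\<omega>. eps_dot n a c \<epsilon> t \<omega> $ i * eps_dot n a c \<epsilon> t \<omega> $ j \<partial>M)
      = \<sigma>2 * (\<Sum>k. score_vec n a c k $ i * score_vec n a c k $ j)" if ij: "i < 2 * n" "j < 2 * n" for i j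
  proof -
    have "(\<integral>\<omega>. eps_dot n a c \<epsilon> t \<omega> $ i * eps_dot n a c \<epsilon> t \<omega> $ j \<partial>M)
      = (\<integral>\<omega>. (\<Sum>k. fps_nth (score_filter n a c i) k * x k \<omega>) * (\<Sum>k. fps_nth (score_filter n a c j) k * x k \<omega>) \<partial>M)"
    proof (rule integral_cong_AE)
      show "AE \<omega> in M. eps_dot n a c \<epsilon> t \<omega> $ i * eps_dot n a c \<epsilon> t \<omega> $ j =
          (\<Sum>k. fps_nth (score_filter n a c i) k * x k \<omega>) * (\<Sum>k. fps_nth (score_filter n a c j) k * x k \<omega>)"
        using eq[OF ij(1)] eq[OF ij(2)] by eventually_elim simp
      show "(\<lambda>\<omega>. eps_dot n a c \<epsilon> t \<omega> $ i * eps_dot n a c \<epsilon> t \<omega> $ j) \<in> borel_measurable M"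
        by (intro borel_measurable_times meas_eps ij)
      show "(\<lambda>\<omega>. (\<Sum>k. fps_nth (score_filter n a c i) k * x k \<omega>) * (\<Sum>k. fps_nth (score_filter n a c j) k * x k \<omega>))
          \<in> borel_measurable M"
        unfolding x_def by measurable
    qed
    also have "\<dots> = \<sigma>2 * (\<Sum>k. fps_nth (score_filter n a c i) k * fps_nth (score_filter n a c j) k)"
    proof (rule integral_linear_process_product[OF r bound[OF ij(1)] bound[OF ij(2)]])
      show "x k \<in> borel_measurable M" for k by (simp add: x_def)
      show "integrable M (\<lambda>\<omega>. x k \<omega> * x l \<omega>)" for k l
        unfolding x_def by (rule white_noise_covariance[OF wn pos])
      show "(\<integral>\<omega>. x k \<omega> * x l \<omega> \<partial>M) = (if k = l then \<sigma>2 else 0)" for k l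
        unfolding x_def by (subst white_noise_covariance(2)[OF wn pos]) auto
    qed
    finally show ?thesis using ij by (simp add: score_vec_def)
  qed
  then show ?thesis
    using pos by (intro eq_matI) (auto simp: fisher_information_def gram_mat_def)
qed

lemma score_vec_summable:
  assumes "zeros_in_open_unit_disc (hat_poly a)" "zeros_in_open_unit_disc (hat_poly c)"
    and "i < 2 * n" "j < 2 * n"
  shows "summable (\<lambda>k. score_vec n a c k $ i * score_vec n a c k $ j)"
proof -
  obtain C r where r: "0 < r" "r < 1"
    and bound: "\<And>i k. i < 2 * n \<Longrightarrow> \<bar>fps_nth (score_filter n a c i) k\<bar> \<le> C * r ^ k"
    using score_filter_geometric[OF assms(1,2)] by metis
  show ?thesis
    using geometric_product_summable[OF r bound[OF assms(3)] bound[OF assms(4)]] assms(3,4)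
    by (simp add: score_vec_def)
qed

section \<open>Kernel of the information matrix\<close>

definition block_poly :: "nat \<Rightarrow> nat \<Rightarrow> real vec \<Rightarrow> real poly" where
  "block_poly n m v = (\<Sum>i<n. monom (v $ (m + i)) i)"

lemma coeff_block_poly: "coeff (block_poly n m v) i = (if i < n then v $ (m + i) else 0)"
  unfolding block_poly_def coeff_sum coeff_monom by (simp add: sum.delta)

lemma degree_block_poly: "n > 0 \<Longrightarrow> degree (block_poly n m v) < n"
  by (rule le_less_trans[of _ "n - 1"], intro degree_le) (auto simp: coeff_block_poly)

lemma fps_of_block_poly_mult_nth:
  "fps_nth (fps_of_poly (block_poly n m v) * f) k = (\<Sum>i<n. v $ (m + i) * fps_nth (fps_X ^ i * f) k)"
proof -
  have "fps_of_poly (block_poly n m v) * f = (\<Sum>i<n. fps_const (v $ (m + i)) * (fps_X ^ i * f))"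
    by (simp add: block_poly_def fps_of_poly_sum fps_of_poly_monom sum_distrib_right mult.assoc)
  then show ?thesis by (simp add: fps_sum_nth)
qed

lemma score_vec_orthogonal_iff:
  "(\<forall>k. (\<Sum>i<2 * n. score_vec n a c k $ i * v $ i) = 0) \<longleftrightarrow>
    block_poly n 0 v * rec_poly c = block_poly n n v * rec_poly a"
proof -
  let ?A = "fps_of_poly (rec_poly a)" and ?C = "fps_of_poly (rec_poly c)"
  let ?p = "fps_of_poly (block_poly n 0 v)" and ?q = "fps_of_poly (block_poly n n v)"
  have split: "(\<Sum>i<n + m. g i) = (\<Sum>i<n. g i) + (\<Sum>i<m. g (n + i))" for g :: "nat \<Rightarrow> real" and m
    by (induction m) auto
  have nth: "(\<Sum>i<2 * n. score_vec n a c k $ i * v $ i) = fps_nth (?p * inverse ?A - ?q * inverse ?C) k" for k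
  proof -
    have "(\<Sum>i<2 * n. score_vec n a c k $ i * v $ i)
        = (\<Sum>i<n + n. fps_nth (score_filter n a c i) k * v $ i)"
      by (intro sum.cong) (auto simp: score_vec_def)
    also have "\<dots> = fps_nth (?p * inverse ?A - ?q * inverse ?C) k"
      unfolding split fps_sub_nth fps_of_block_poly_mult_nth
      by (simp add: score_filter_def sum_negf mult.commute)
    finally show ?thesis .
  qed
  have AA: "?A * inverse ?A = 1" "?C * inverse ?C = 1" by (rule rec_poly_inverse)+
  have "(\<forall>k. (\<Sum>i<2 * n. score_vec n a c k $ i * v $ i) = 0) \<longleftrightarrow> ?p * inverse ?A - ?q * inverse ?C = 0"
    unfolding nth by (simp add: fps_eq_iff)
  \<comment> \<open>The series a and c are units, having constant coefficient 1, so one may multiply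
    by a c and by its inverse.\<close>
  also have "\<dots> \<longleftrightarrow> ?p * ?C = ?q * ?A"
  proof
    assume "?p * inverse ?A - ?q * inverse ?C = 0"
    then have "?p * inverse ?A * (?A * ?C) = ?q * inverse ?C * (?A * ?C)" by simp
    moreover have "?p * inverse ?A * (?A * ?C) = ?p * ?C * (?A * inverse ?A)"
      "?q * inverse ?C * (?A * ?C) = ?q * ?A * (?C * inverse ?C)" by (simp_all only: mult_ac)
    ultimately show "?p * ?C = ?q * ?A" by (simp only: AA mult_1_right)
  next
    assume "?p * ?C = ?q * ?A"
    then have "?p * ?C * (inverse ?A * inverse ?C) = ?q * ?A * (inverse ?A * inverse ?C)" by simp
    moreover have "?p * ?C * (inverse ?A * inverse ?C) = ?p * inverse ?A * (?C * inverse ?C)"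
      "?q * ?A * (inverse ?A * inverse ?C) = ?q * inverse ?C * (?A * inverse ?A)" by (simp_all only: mult_ac)
    ultimately show "?p * inverse ?A - ?q * inverse ?C = 0" by (simp only: AA mult_1_right diff_self)
  qed
  also have "\<dots> \<longleftrightarrow> block_poly n 0 v * rec_poly c = block_poly n n v * rec_poly a"
    by (simp only: fps_of_poly_mult[symmetric] fps_of_poly_eq_iff)
  finally show ?thesis .
qed

lemma invertible_gram_mat_iff:
  assumes n: "n \<ge> 1"
    and z: "zeros_in_open_unit_disc (hat_poly a)" "zeros_in_open_unit_disc (hat_poly c)"
  shows "invertible_mat (gram_mat (2 * n) (score_vec n a c)) \<longleftrightarrow>
    \<not> (\<exists>p q. (p \<noteq> 0 \<or> q \<noteq> 0) \<and> degree p < n \<and> degree q < n \<and> p * rec_poly c = q * rec_poly a)"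
proof -
  have ker: "gram_mat (2 * n) (score_vec n a c) *\<^sub>v v = 0\<^sub>v (2 * n) \<longleftrightarrow>
      block_poly n 0 v * rec_poly c = block_poly n n v * rec_poly a" if "v \<in> carrier_vec (2 * n)" for v
    unfolding score_vec_orthogonal_iff[symmetric]
    using that by (rule gram_mat_kernel) (rule score_vec_summable[OF z])
  have zero: "v = 0\<^sub>v (2 * n)" if v: "v \<in> carrier_vec (2 * n)"
    and p: "block_poly n 0 v = 0" and q: "block_poly n n v = 0" for v
  proof (rule eq_vecI)
    fix i assume "i < dim_vec (0\<^sub>v (2 * n))"
    then have i: "i < 2 * n" by simp
    show "v $ i = 0\<^sub>v (2 * n) $ i"
    proof (cases "i < n")
      case True
      then show ?thesis using arg_cong[OF p, of "\<lambda>p. coeff p i"] i by (simp add: coeff_block_poly)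
    next
      case False
      then have "i - n < n" using i by simp
      then show ?thesis using False arg_cong[OF q, of "\<lambda>p. coeff p (i - n)"] i by (simp add: coeff_block_poly)
    qed
  qed (use v in simp)
  show ?thesis
    unfolding invertible_mat_iff_kernel[OF gram_mat_carrier]
  proof (rule iffI)
    assume inj: "\<forall>v\<in>carrier_vec (2 * n). gram_mat (2 * n) (score_vec n a c) *\<^sub>v v = 0\<^sub>v (2 * n) \<longrightarrow> v = 0\<^sub>v (2 * n)"
    show "\<not> (\<exists>p q. (p \<noteq> 0 \<or> q \<noteq> 0) \<and> degree p < n \<and> degree q < n \<and> p * rec_poly c = q * rec_poly a)"
    proof
      assume "\<exists>p q. (p \<noteq> 0 \<or> q \<noteq> 0) \<and> degree p < n \<and> degree q < n \<and> p * rec_poly c = q * rec_poly a"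
      then obtain p q where pq: "p \<noteq> 0 \<or> q \<noteq> 0" "degree p < n" "degree q < n" "p * rec_poly c = q * rec_poly a"
        by blast
      \<comment> \<open>The degree bounds ensure that the n coefficients stored in each half recover
        p and q completely.\<close>
      define v where "v = Matrix.vec (2 * n) (\<lambda>i. if i < n then coeff p i else coeff q (i - n))"
      have v: "v \<in> carrier_vec (2 * n)" by (simp add: v_def)
      have bp: "block_poly n 0 v = p"
      proof (rule poly_eqI)
        show "coeff (block_poly n 0 v) i = coeff p i" for i
          using coeff_eq_0[of p i] pq(2) by (cases "i < n") (simp_all add: coeff_block_poly v_def)
      qed
      have bq: "block_poly n n v = q"
      proof (rule poly_eqI)
        show "coeff (block_poly n n v) i = coeff q i" for i
          using coeff_eq_0[of q i] pq(3) by (cases "i < n") (simp_all add: coeff_block_poly v_def)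
      qed
      note b = bp bq
      then have "v = 0\<^sub>v (2 * n)" using inj ker[OF v] v pq(4) by simp
      moreover have "block_poly n m (0\<^sub>v (2 * n)) = 0" if "m \<le> n" for m
        using that by (intro poly_eqI) (simp add: coeff_block_poly)
      ultimately show False using b pq(1) by auto
    qed
  next
    assume no: "\<not> (\<exists>p q. (p \<noteq> 0 \<or> q \<noteq> 0) \<and> degree p < n \<and> degree q < n \<and> p * rec_poly c = q * rec_poly a)"
    show "\<forall>v\<in>carrier_vec (2 * n). gram_mat (2 * n) (score_vec n a c) *\<^sub>v v = 0\<^sub>v (2 * n) \<longrightarrow> v = 0\<^sub>v (2 * n)"
    proof (intro ballI impI)
      fix v assume v: "v \<in> carrier_vec (2 * n)" "gram_mat (2 * n) (score_vec n a c) *\<^sub>v v = 0\<^sub>v (2 * n)"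
      have deg: "degree (block_poly n m v) < n" for m using n by (intro degree_block_poly) simp
      have "block_poly n 0 v = 0 \<and> block_poly n n v = 0"
        using no deg ker[OF v(1)] v(2) by blast
      then show "v = 0\<^sub>v (2 * n)" using zero[OF v(1)] by blast
    qed
  qed
qed

text \<open>Both polynomials have degree n whatever their coefficients, so
  \<open>common_factor_iff\<close> always applies; reversal then moves the relation to
  \<open>rec_poly\<close>.\<close>

lemma hat_common_factor_iff:
  assumes "n \<ge> 1" "a \<in> carrier_vec n" "c \<in> carrier_vec n"
  shows "has_common_factor (hat_poly a) (hat_poly c) \<longleftrightarrow>
    (\<exists>p q. (p \<noteq> 0 \<or> q \<noteq> 0) \<and> degree p < n \<and> degree q < n \<and> p * rec_poly c = q * rec_poly a)"
proof -
  have dim: "dim_vec a = n" "dim_vec c = n" using assms by auto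
  have "hat_poly a \<noteq> 0" "hat_poly c \<noteq> 0"
    using degree_hat_poly[of a] degree_hat_poly[of c] dim assms(1) by auto
  then show ?thesis
    using common_factor_iff[of "hat_poly a" "hat_poly c" n] hat_syzygy_iff[OF dim] assms(1)
    by (simp add: degree_hat_poly dim)
qed

text \<open>The guard makes the larger degree equal to n. With a_n = c_n = 0 the pair
  \<open>rec_poly a\<close>, \<open>rec_poly c\<close> would itself satisfy the relation and the
  degree bounds, even for coprime polynomials.\<close>

lemma rec_common_factor_iff:
  assumes "n \<ge> 1" "a \<in> carrier_vec n" "c \<in> carrier_vec n"
    and "arma_coeff a n \<noteq> 0 \<or> arma_coeff c n \<noteq> 0"
  shows "has_common_factor (rec_poly a) (rec_poly c) \<longleftrightarrow>
    (\<exists>p q. (p \<noteq> 0 \<or> q \<noteq> 0) \<and> degree p < n \<and> degree q < n \<and> p * rec_poly c = q * rec_poly a)"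
proof -
  have dim: "dim_vec a = n" "dim_vec c = n" using assms by auto
  have "degree (rec_poly b) = n" if "arma_coeff b n \<noteq> 0" "dim_vec b = n" for b
    using that degree_rec_poly_le[of b] le_degree[of "rec_poly b" n] by (simp add: coeff_rec_poly)
  then have "max (degree (rec_poly a)) (degree (rec_poly c)) = n"
    using assms(4) dim degree_rec_poly_le[of a] degree_rec_poly_le[of c] by (auto simp: max_def)
  then show ?thesis using assms(1) by (intro common_factor_iff) auto
qed

text \<open>Existence and uniqueness for G are inherited from F: conjugation by \<open>M_inv\<close>
  sends any solution to K, and conjugation by \<open>M_mat\<close> sends K to a solution. This makes
  the \<open>THE\<close> in \<open>H_mat\<close> well defined.\<close>

lemma H_mat_eq:
  assumes a: "a \<in> carrier_vec n" and c: "c \<in> carrier_vec n" and n: "n \<ge> 1"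
    and K: "\<And>X. stein_solution (F_mat n a c) (B_vec n) X \<longleftrightarrow> X = K"
  shows "H_mat n a c = M_mat n c a * K * transpose_mat (M_mat n c a)"
    and "M_inv n c a * H_mat n a c * transpose_mat (M_inv n c a) = K"
proof -
  let ?T = "M_mat n c a" and ?U = "M_inv n c a"
  note F = F_mat_carrier[OF a c] and G = G_mat_carrier[OF a c]
  note T = M_mat_carrier[of n c a] and U = M_inv_carrier[of n c a]
  note TU = M_mat_M_inv[of n c a] and UT = M_inv_M_mat[of n c a]
  have B: "B_vec n \<in> carrier_vec (2 * n)" by simp
  have eP: "eP_vec n = ?T *\<^sub>v B_vec n" by (rule M_mat_B_vec[OF n, symmetric])
  have Kc: "K \<in> carrier_mat (2 * n) (2 * n)" using K[of K] B by (auto simp: stein_solution_def)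
  have ePc: "eP_vec n \<in> carrier_vec (2 * n)" unfolding eP using T B by simp
  \<comment> \<open>This is T F = G T multiplied by the inverse of T on both sides.\<close>
  have UG: "?U * G_mat n a c = F_mat n a c * ?U"
  proof -
    have "?U * G_mat n a c = ?U * (G_mat n a c * ?T) * ?U"
      using T U G by (simp add: assoc_mult_mat[of _ "2*n" "2*n" _ "2*n" _ "2*n"] TU)
    also have "\<dots> = ?U * (?T * F_mat n a c) * ?U" by (simp only: M_mat_F_mat[OF a c])
    also have "\<dots> = (?U * ?T) * F_mat n a c * ?U"
      using T U F by (simp add: assoc_mult_mat[of _ "2*n" "2*n" _ "2*n" _ "2*n"])
    finally show ?thesis using F by (simp add: UT)
  qed
  have Ue: "?U *\<^sub>v eP_vec n = B_vec n"
    unfolding eP using assoc_mult_mat_vec[OF U T B] B by (simp add: UT)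
  have sandwich: "Q * (R * Y * transpose_mat R) * transpose_mat Q = Y"
    if "Q \<in> carrier_mat (2 * n) (2 * n)" "R \<in> carrier_mat (2 * n) (2 * n)" "Y \<in> carrier_mat (2 * n) (2 * n)"
      "Q * R = 1\<^sub>m (2 * n)" for Q R Y :: "real mat"
  proof -
    have "Q * (R * Y * transpose_mat R) * transpose_mat Q = (Q * R) * Y * transpose_mat (Q * R)"
      using that(1-3) by (simp add: transpose_mult[of _ "2*n" "2*n" _ "2*n"] assoc_mult_mat[of _ "2*n" "2*n" _ "2*n" _ "2*n"])
    then show ?thesis using that by simp
  qed
  have "stein_solution (G_mat n a c) (eP_vec n) Y \<longleftrightarrow> Y = ?T * K * transpose_mat ?T" for Y
  proof
    assume Y: "stein_solution (G_mat n a c) (eP_vec n) Y"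
    then have Yc: "Y \<in> carrier_mat (2 * n) (2 * n)" using ePc by (auto simp: stein_solution_def)
    have "?U * Y * transpose_mat ?U = K"
      using stein_solution_conjugate[OF G F U T UT TU UG ePc Ue Y] K by blast
    then show "Y = ?T * K * transpose_mat ?T" using sandwich[OF T U Yc TU] by simp
  next
    assume "Y = ?T * K * transpose_mat ?T"
    then show "stein_solution (G_mat n a c) (eP_vec n) Y"
      using stein_solution_conjugate[OF F G T U TU UT M_mat_F_mat[OF a c] B eP[symmetric]] K by blast
  qed
  then show H: "H_mat n a c = ?T * K * transpose_mat ?T" unfolding H_mat_def by blast
  show "?U * H_mat n a c * transpose_mat ?U = K"
    unfolding H by (rule sandwich[OF U T Kc UT])
qed

theorem theorem6p1:
  fixes n :: nat and a c :: "real vec" and \<sigma>2 :: real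
    and M :: "'w measure" and \<epsilon> y :: "int \<Rightarrow> 'w \<Rightarrow> real" and t :: int
  assumes "n \<ge> 1"
    and "a \<in> carrier_vec n" and "c \<in> carrier_vec n"
    and "zeros_in_open_unit_disc (hat_poly a)"
    and "zeros_in_open_unit_disc (hat_poly c)"
    and "\<sigma>2 > 0"
    and "arma_process M \<sigma>2 a c \<epsilon> y"
  shows "fisher_information M \<sigma>2 n a c \<epsilon> t
           = M_inv n c a * H_mat n a c * transpose_mat (M_inv n c a)
       \<and> (\<forall>X. stein_solution (F_mat n a c) (B_vec n) X
               \<longleftrightarrow> X = fisher_information M \<sigma>2 n a c \<epsilon> t)
       \<and> (\<forall>\<tau>2 (M' :: 'v measure) \<epsilon>' y' t'. \<tau>2 > 0 \<longrightarrow> arma_process M' \<tau>2 a c \<epsilon>' y' \<longrightarrow>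
            fisher_information M' \<tau>2 n a c \<epsilon>' t' = fisher_information M \<sigma>2 n a c \<epsilon> t)
       \<and> (arma_coeff a n \<noteq> 0 \<or> arma_coeff c n \<noteq> 0 \<longrightarrow>
            (invertible_mat (fisher_information M \<sigma>2 n a c \<epsilon> t)
               \<longleftrightarrow> \<not> has_common_factor (rec_poly a) (rec_poly c)))
       \<and> (invertible_mat (fisher_information M \<sigma>2 n a c \<epsilon> t)
               \<longleftrightarrow> \<not> has_common_factor (hat_poly a) (hat_poly c))"
proof -
  define K where "K = gram_mat (2 * n) (score_vec n a c)"
  note n = assms(1) and a = assms(2) and c = assms(3) and za = assms(4) and zc = assms(5)
  have "stein_solution (F_mat n a c) (B_vec n) K"
    unfolding K_def
    by (rule stein_solution_gram_mat[OF F_mat_carrier[OF a c] B_vec_carrier])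
      (simp_all only: score_vec_carrier score_vec_0[OF n] score_vec_Suc[OF n a c] score_vec_summable[OF za zc])
  then have stein: "stein_solution (F_mat n a c) (B_vec n) X \<longleftrightarrow> X = K" for X
    using stein_solution_unique[OF F_mat_carrier[OF a c] B_vec_carrier F_mat_pow_tendsto_0[OF a za c zc]]
    by blast
  have "fisher_information M \<sigma>2 n a c \<epsilon> t = K"
    unfolding K_def by (rule fisher_information_eq_gram_mat[OF za zc assms(6)])
      (use assms(7) in \<open>simp add: arma_process_def\<close>)
  \<comment> \<open>Both information matrices equal K, which depends only on n, a and c; the second
    process may live on a sample space of another type.\<close>
  moreover have "fisher_information M' \<tau>2 n a c \<epsilon>' t' = K"
    if "\<tau>2 > 0" "arma_process M' \<tau>2 a c \<epsilon>' y'"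
    for \<tau>2 and M' :: "'v measure" and \<epsilon>' y' :: "int \<Rightarrow> 'v \<Rightarrow> real" and t'
    unfolding K_def by (rule fisher_information_eq_gram_mat[OF za zc that(1)])
      (use that(2) in \<open>simp add: arma_process_def\<close>)
  moreover note H_mat_eq(2)[OF a c n stein] stein invertible_gram_mat_iff[OF n za zc, folded K_def]
    hat_common_factor_iff[OF n a c] rec_common_factor_iff[OF n a c]
  ultimately show ?thesis by simp
qed

end
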